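(* Let $v\in\mathbf{A}^{r\times n}$ and let $k\ge1$. If $k\le\operatorname{rk}(M(v))$, then the multiplicity of the irreducible $\mathfrak{S}_n$-representation indexed by the partition $(n-k+1,1^{k-1})$ in $\mathfrak{S}(v)$ is the number of nbc bases of the truncation of $M(v)$ to rank $k$. If $k>\operatorname{rk}(M(v))$, this multiplicity is zero.
   Context: $\mathbf{k}$ is an algebraically closed field of characteristic zero and $\mathbf{A}^{r\times n}$ is the space of $r$-by-$n$ matrices over $\mathbf{k}$. For $v\in\mathbf{A}^{r\times n}$ with columns $v_1,\dots,v_n\in\mathbf{k}^r$, $M(v)$ is the matroid on $\{1,\dots,n\}$ whose independent sets are the sets $I$ such that the columns of $v$ indexed by $I$ are linearly independent. $\mathfrak{S}(v)$ is the cyclic $\mathfrak{S}_n$-submodule of $(\mathbf{k}^r)^{\otimes n}$ (with $\mathfrak{S}_n$ permuting tensor factors) generated by $v_1\otimes\dots\otimes v_n$. Irreducible representations of $\mathfrak{S}_n$ are indexed by partitions of $n$ in the usual way, $(n)$ being the trivial representation. The truncation of a matroid $M$ to rank $k\le\operatorname{rk}(M)$ is the matroid whose independent sets are the independent sets of $M$ of size at most $k$. For a matroid on a totally ordered ground set (here $\{1,\dots,n\}$ with its usual order), a broken circuit is a circuit (minimal dependent set) with its smallest element removed. An nbc set is a set containing no broken circuit, and an nbc basis is a basis of the matroid that is an nbc set. *)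

theory Defs
  imports
    "HOL-Library.FuncSet"
    "HOL-Library.Function_Algebras"
    "HOL-Combinatorics.Permutations"
    "HOL-Computational_Algebra.Polynomial"
    "Jordan_Normal_Form.Matrix"
begin

section \<open>Matroids\<close>

text \<open>
  A matroid is given by its ground set and its family of independent sets; the matroid axioms
  are not part of the type.
\<close>

record 'a matroid =
  ground :: "'a set"
  indep :: "'a set set"

definition matroid_rank :: "'a matroid \<Rightarrow> nat" where
  "matroid_rank M = Max (card ` indep M)"

definition matroid_basis :: "'a matroid \<Rightarrow> 'a set \<Rightarrow> bool" where
  "matroid_basis M B \<longleftrightarrow> B \<in> indep M \<and> (\<forall>I \<in> indep M. B \<subseteq> I \<longrightarrow> I = B)"

definition matroid_circuit :: "'a matroid \<Rightarrow> 'a set \<Rightarrow> bool" where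
  "matroid_circuit M C \<longleftrightarrow>
     C \<subseteq> ground M \<and> C \<notin> indep M \<and> (\<forall>D. D \<subset> C \<longrightarrow> D \<in> indep M)"

definition truncation :: "'a matroid \<Rightarrow> nat \<Rightarrow> 'a matroid" where
  "truncation M k = \<lparr>ground = ground M, indep = {I \<in> indep M. card I \<le> k}\<rparr>"

definition broken_circuit :: "'a::linorder matroid \<Rightarrow> 'a set \<Rightarrow> bool" where
  "broken_circuit M B \<longleftrightarrow> (\<exists>C. matroid_circuit M C \<and> B = C - {Min C})"

definition nbc_set :: "'a::linorder matroid \<Rightarrow> 'a set \<Rightarrow> bool" where
  "nbc_set M S \<longleftrightarrow> S \<subseteq> ground M \<and> \<not> (\<exists>B. broken_circuit M B \<and> B \<subseteq> S)"

definition nbc_bases :: "'a::linorder matroid \<Rightarrow> 'a set set" where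
  "nbc_bases M = {B. matroid_basis M B \<and> nbc_set M B}"

text \<open>
  Columns are numbered from \<open>0\<close>, so the ground set is \<open>{0, \<dots>, n - 1}\<close> rather than
  \<open>{1, \<dots>, n}\<close>. Independence is that of the indexed family of columns: two equal columns are
  dependent.
\<close>

definition column_matroid :: "'k::field mat \<Rightarrow> nat matroid" where
  "column_matroid v =
     \<lparr>ground = {..<dim_col v},
      indep = {I. I \<subseteq> {..<dim_col v} \<and>
                  (\<forall>c :: nat \<Rightarrow> 'k. (\<forall>a<dim_row v. (\<Sum>j\<in>I. c j * v $$ (a, j)) = 0) \<longrightarrow>
                     (\<forall>j\<in>I. c j = 0))}\<rparr>"


section \<open>Representations of the symmetric group\<close>

text \<open>
  All representations below live inside spaces of \<open>'k\<close>-valued functions. The group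
  \<open>\<SS>\<^sub>n\<close> consists of the \<open>\<sigma>\<close> with \<open>\<sigma> permutes {..<n}\<close>, and
  \<open>act \<sigma>\<close> is the operator by which \<open>\<sigma>\<close> acts.
\<close>

definition fun_scale :: "'k::field \<Rightarrow> ('x \<Rightarrow> 'k) \<Rightarrow> ('x \<Rightarrow> 'k)" where
  "fun_scale c f = (\<lambda>x. c * f x)"

interpretation funspace: vector_space "fun_scale :: 'k::field \<Rightarrow> ('x \<Rightarrow> 'k) \<Rightarrow> ('x \<Rightarrow> 'k)"
  by unfold_locales (auto simp: fun_scale_def algebra_simps)

definition submodule ::
  "nat \<Rightarrow> ((nat \<Rightarrow> nat) \<Rightarrow> ('x \<Rightarrow> 'k) \<Rightarrow> ('x \<Rightarrow> 'k)) \<Rightarrow> ('x \<Rightarrow> 'k::field) set \<Rightarrow> bool" where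
  "submodule n act W \<longleftrightarrow>
     funspace.subspace W \<and> (\<forall>\<sigma>. \<sigma> permutes {..<n} \<longrightarrow> (\<forall>w\<in>W. act \<sigma> w \<in> W))"

definition cyclic_submodule ::
  "nat \<Rightarrow> ((nat \<Rightarrow> nat) \<Rightarrow> ('x \<Rightarrow> 'k) \<Rightarrow> ('x \<Rightarrow> 'k)) \<Rightarrow> ('x \<Rightarrow> 'k::field) \<Rightarrow> ('x \<Rightarrow> 'k) set" where
  "cyclic_submodule n act t = funspace.span {act \<sigma> t | \<sigma>. \<sigma> permutes {..<n}}"

definition irreducible_module ::
  "nat \<Rightarrow> ((nat \<Rightarrow> nat) \<Rightarrow> ('x \<Rightarrow> 'k) \<Rightarrow> ('x \<Rightarrow> 'k)) \<Rightarrow> ('x \<Rightarrow> 'k::field) set \<Rightarrow> bool" where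
  "irreducible_module n act W \<longleftrightarrow>
     submodule n act W \<and> W \<noteq> {0} \<and>
     (\<forall>W'. submodule n act W' \<and> W' \<subseteq> W \<longrightarrow> W' = {0} \<or> W' = W)"

definition isomorphic_modules ::
  "nat \<Rightarrow> ((nat \<Rightarrow> nat) \<Rightarrow> ('x \<Rightarrow> 'k) \<Rightarrow> ('x \<Rightarrow> 'k)) \<Rightarrow> ('x \<Rightarrow> 'k::field) set \<Rightarrow>
   ((nat \<Rightarrow> nat) \<Rightarrow> ('y \<Rightarrow> 'k) \<Rightarrow> ('y \<Rightarrow> 'k)) \<Rightarrow> ('y \<Rightarrow> 'k) set \<Rightarrow> bool" where
  "isomorphic_modules n act V act' V' \<longleftrightarrow>
     (\<exists>f. bij_betw f V V' \<and>
        (\<forall>x\<in>V. \<forall>y\<in>V. f (x + y) = f x + f y) \<and>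
        (\<forall>c. \<forall>x\<in>V. f (fun_scale c x) = fun_scale c (f x)) \<and>
        (\<forall>\<sigma>. \<sigma> permutes {..<n} \<longrightarrow> (\<forall>x\<in>V. f (act \<sigma> x) = act' \<sigma> (f x))))"

definition irreducible_decomposition ::
  "nat \<Rightarrow> ((nat \<Rightarrow> nat) \<Rightarrow> ('x \<Rightarrow> 'k) \<Rightarrow> ('x \<Rightarrow> 'k)) \<Rightarrow> ('x \<Rightarrow> 'k::field) set \<Rightarrow>
   nat \<Rightarrow> (nat \<Rightarrow> ('x \<Rightarrow> 'k) set) \<Rightarrow> bool" where
  "irreducible_decomposition n act W l U \<longleftrightarrow>
     (\<forall>i<l. irreducible_module n act (U i) \<and> U i \<subseteq> W) \<and>
     (\<forall>w\<in>W. \<exists>!u. u \<in> (\<Pi>\<^sub>E i\<in>{..<l}. U i) \<and> w = (\<Sum>i<l. u i))"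

text \<open>
  The multiplicity of the irreducible module \<open>L\<close> in \<open>W\<close>: the number of summands isomorphic to
  \<open>L\<close> in a decomposition of \<open>W\<close> into irreducible submodules. For finite-dimensional \<open>W\<close> in
  characteristic zero a decomposition exists, and the number does not depend on it.
\<close>

definition module_multiplicity ::
  "nat \<Rightarrow> ((nat \<Rightarrow> nat) \<Rightarrow> ('y \<Rightarrow> 'k) \<Rightarrow> ('y \<Rightarrow> 'k)) \<Rightarrow> ('y \<Rightarrow> 'k::field) set \<Rightarrow>
   ((nat \<Rightarrow> nat) \<Rightarrow> ('x \<Rightarrow> 'k) \<Rightarrow> ('x \<Rightarrow> 'k)) \<Rightarrow> ('x \<Rightarrow> 'k) set \<Rightarrow> nat" where
  "module_multiplicity n act' L act W =
     (THE m. \<exists>l U. irreducible_decomposition n act W l U \<and>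
        m = card {i. i < l \<and> isomorphic_modules n act (U i) act' L})"


section \<open>The irreducible representation indexed by a partition\<close>

definition is_partition :: "nat \<Rightarrow> nat list \<Rightarrow> bool" where
  "is_partition n lam \<longleftrightarrow> sorted_wrt (\<ge>) lam \<and> 0 \<notin> set lam \<and> sum_list lam = n"

text \<open>
  The cells of the Young diagram of \<open>lam\<close> are filled with \<open>0, \<dots>, n - 1\<close> row by row;
  \<open>tab_row lam p\<close> and \<open>tab_col lam c\<close> are the sets of entries of a row and of a column.
\<close>

definition tab_row :: "nat list \<Rightarrow> nat \<Rightarrow> nat set" where
  "tab_row lam p = {sum_list (take p lam) + c | c. c < lam ! p}"

definition tab_col :: "nat list \<Rightarrow> nat \<Rightarrow> nat set" where
  "tab_col lam c = {sum_list (take p lam) + c | p. p < length lam \<and> c < lam ! p}"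

definition row_stabilizer :: "nat \<Rightarrow> nat list \<Rightarrow> (nat \<Rightarrow> nat) set" where
  "row_stabilizer n lam =
     {\<sigma>. \<sigma> permutes {..<n} \<and> (\<forall>p<length lam. \<sigma> ` tab_row lam p = tab_row lam p)}"

definition col_stabilizer :: "nat \<Rightarrow> nat list \<Rightarrow> (nat \<Rightarrow> nat) set" where
  "col_stabilizer n lam =
     {\<sigma>. \<sigma> permutes {..<n} \<and> (\<forall>c. \<sigma> ` tab_col lam c = tab_col lam c)}"

text \<open>
  An element \<open>\<Sum>\<^sub>g x\<^sub>g g\<close> of the group algebra is encoded as the function \<open>g \<mapsto> x\<^sub>g\<close>, zero off
  \<open>\<SS>\<^sub>n\<close>; then left multiplication by \<open>\<sigma>\<close> is \<open>left_mult \<sigma>\<close>. The Young symmetrizer is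
  \<open>(\<Sum>p. p) (\<Sum>q. sgn(q) q) = \<Sum>p q. sgn(q) p q\<close>, where \<open>p\<close> runs over the row stabilizer and
  \<open>q\<close> over the column stabilizer, and the Specht module is the left ideal it generates. With
  these conventions the partition \<open>(n)\<close> gives the trivial representation and \<open>(1\<^sup>n)\<close> the sign.
\<close>

definition left_mult ::
  "(nat \<Rightarrow> nat) \<Rightarrow> ((nat \<Rightarrow> nat) \<Rightarrow> 'k) \<Rightarrow> ((nat \<Rightarrow> nat) \<Rightarrow> 'k)" where
  "left_mult \<sigma> x = (\<lambda>g. x (inv_into UNIV \<sigma> \<circ> g))"

definition young_symmetrizer :: "nat \<Rightarrow> nat list \<Rightarrow> (nat \<Rightarrow> nat) \<Rightarrow> 'k::field" where
  "young_symmetrizer n lam =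
     (\<lambda>g. \<Sum>(p, q) \<in> {(p, q) \<in> row_stabilizer n lam \<times> col_stabilizer n lam. p \<circ> q = g}.
            of_int (sign q))"

definition specht_module :: "nat \<Rightarrow> nat list \<Rightarrow> ((nat \<Rightarrow> nat) \<Rightarrow> 'k::field) set" where
  "specht_module n lam = cyclic_submodule n left_mult (young_symmetrizer n lam)"

text \<open>
  If \<open>lam\<close> is not a partition of \<open>n\<close>, it indexes no irreducible representation, and the
  multiplicity is zero by convention.
\<close>

definition irrep_multiplicity ::
  "nat \<Rightarrow> nat list \<Rightarrow> ((nat \<Rightarrow> nat) \<Rightarrow> ('x \<Rightarrow> 'k) \<Rightarrow> ('x \<Rightarrow> 'k)) \<Rightarrow> ('x \<Rightarrow> 'k::field) set \<Rightarrow> nat" where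
  "irrep_multiplicity n lam act W =
     (if is_partition n lam
      then module_multiplicity n left_mult (specht_module n lam :: ((nat \<Rightarrow> nat) \<Rightarrow> 'k) set) act W
      else 0)"

definition hook :: "nat \<Rightarrow> nat \<Rightarrow> nat list" where
  "hook n k = (n + 1 - k) # replicate (k - 1) 1"


section \<open>The module generated by a decomposable tensor\<close>

text \<open>
  A tensor in the \<open>n\<close>-th tensor power of \<open>'k\<^sup>r\<close> is encoded by its coordinates in the basis
  \<open>e\<^bsub>w 0\<^esub> \<otimes> \<dots> \<otimes> e\<^bsub>w (n - 1)\<^esub>\<close>, where \<open>w\<close> runs over \<open>tensor_words r n\<close>: a function which is
  zero off \<open>tensor_words r n\<close>. In these coordinates the permutation of tensor factors
  \<open>\<sigma> (u\<^sub>0 \<otimes> \<dots> \<otimes> u\<^bsub>n-1\<^esub>) = u\<^bsub>\<sigma>\<inverse> 0\<^esub> \<otimes> \<dots> \<otimes> u\<^bsub>\<sigma>\<inverse> (n-1)\<^esub>\<close> is precomposition with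
  \<open>w \<mapsto> w \<circ> \<sigma>\<close>.
\<close>

definition tensor_words :: "nat \<Rightarrow> nat \<Rightarrow> (nat \<Rightarrow> nat) set" where
  "tensor_words r n = ({..<n} \<rightarrow>\<^sub>E {..<r})"

definition permute_factors ::
  "(nat \<Rightarrow> nat) \<Rightarrow> ((nat \<Rightarrow> nat) \<Rightarrow> 'k) \<Rightarrow> ((nat \<Rightarrow> nat) \<Rightarrow> 'k)" where
  "permute_factors \<sigma> T = (\<lambda>w. T (w \<circ> \<sigma>))"

definition column_tensor :: "'k::field mat \<Rightarrow> (nat \<Rightarrow> nat) \<Rightarrow> 'k" where
  "column_tensor v =
     (\<lambda>w. if w \<in> tensor_words (dim_row v) (dim_col v)
          then \<Prod>j<dim_col v. v $$ (w j, j) else 0)"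

definition tensor_module :: "'k::field mat \<Rightarrow> ((nat \<Rightarrow> nat) \<Rightarrow> 'k) set" where
  "tensor_module v = cyclic_submodule (dim_col v) permute_factors (column_tensor v)"

end

theory Submission
  imports Defs
begin

text \<open>
  Let \<open>c\<close> be the Young symmetrizer of the hook. Since \<open>c \<cdot> kG \<cdot> c\<close> is the line spanned by \<open>c\<close>,
  where \<open>G = \<SS>\<^sub>n\<close>, the left ideal of \<open>c\<close> is irreducible, and \<open>c\<close> maps an irreducible module to a
  line or to zero according as the module is isomorphic to that left ideal or not. The
  multiplicity is therefore \<open>dim c\<cdot>W\<close> for \<open>W = \<SS>(v)\<close> (\<open>multiplicity_eq_dim\<close>), and
  \<open>c\<cdot>W\<close> is spanned by the tensors \<open>c\<cdot>g\<cdot>(v\<^sub>0 \<otimes> \<dots> \<otimes> v\<^bsub>n-1\<^esub>)\<close> with \<open>g \<in> \<SS>\<^sub>n\<close>.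

  Up to sign such a tensor depends only on the \<open>k\<close>-set \<open>I\<close> of columns that \<open>g\<close> places in the
  first column of the hook; call it \<open>E\<^sub>I\<close>. Regard the columns as linear forms \<open>l\<^sub>j\<close> on the dual
  space. Then \<open>E\<^sub>I\<close> is, up to a nonzero scalar, the contraction with the Euler vector field of
  \<open>(\<Prod>j. l\<^sub>j) \<cdot> \<And>\<^bsub>i\<in>I\<^esub> dlog l\<^sub>i\<close>, so that the span of all \<open>E\<^sub>I\<close> is a graded piece of the image of
  the differential of the Orlik-Solomon algebra of the matroid. The dimension of that
  piece is the number of nbc sets of size \<open>k\<close> that contain the smallest element \<open>0\<close>, and these sets
  are the nbc bases of the truncation to rank \<open>k\<close> (\<open>nbc_bases_truncation\<close>).

  The dimension is found with tensors alone. The relations of the Orlik-Solomon algebra become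
  exchange relations that rewrite \<open>E\<^sub>I\<close> in terms of \<open>E\<^sub>J\<close> with \<open>J\<close> of smaller sum; hence the
  \<open>E\<^sub>I\<close> with \<open>I\<close> nbc span (\<open>straightening\<close>). For their independence \<open>E\<^sub>I\<close> is evaluated at products
  of covectors, which gives a \<open>k \<times> k\<close> minor times a product of linear forms. These functions are
  independent by deletion and contraction of the last column: restriction to the hyperplane of the
  last column kills the terms with \<open>n - 1 \<notin> I\<close> and is a contraction on the others; the terms that
  remain are divisible by the last linear form (\<open>det_forms_independent\<close>).
\<close>

section \<open>Modules over the symmetric group\<close>

interpretation funspace_pair: vector_space_pair
  "fun_scale :: 'k::field \<Rightarrow> ('x \<Rightarrow> 'k) \<Rightarrow> ('x \<Rightarrow> 'k)"
  "fun_scale :: 'k::field \<Rightarrow> ('y \<Rightarrow> 'k) \<Rightarrow> ('y \<Rightarrow> 'k)"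
  by unfold_locales

lemma fun_scale_apply: "fun_scale a f x = a * f x"
  by (simp add: fun_scale_def)

lemma sum_fun_apply: "(\<Sum>i\<in>I. f i) x = (\<Sum>i\<in>I. f i x)"
  for f :: "'i \<Rightarrow> 'x \<Rightarrow> 'k::comm_monoid_add"
  by (induction I rule: infinite_finite_induct) auto

lemma card_le_dim:
  fixes B :: "('x \<Rightarrow> 'k::field) set"
  assumes "funspace.independent B" "B \<subseteq> W" "W \<subseteq> funspace.span F" "finite F"
  shows "finite B \<and> card B \<le> funspace.dim W"
proof -
  obtain C where C: "C \<subseteq> W" "funspace.independent C" "W \<subseteq> funspace.span C" "card C = funspace.dim W"
    using funspace.basis_exists by blast
  have "finite C"
    using funspace.independent_span_bound[OF assms(4) C(2)] C(1) assms(3) by blast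
  then show ?thesis
    using funspace.independent_span_bound[of C B] assms C by auto
qed

lemma dim_less:
  fixes W :: "('x \<Rightarrow> 'k::field) set"
  assumes "funspace.subspace W'" "W' \<subset> W" "W \<subseteq> funspace.span F" "finite F"
  shows "funspace.dim W' < funspace.dim W"
proof -
  obtain B where B: "B \<subseteq> W'" "funspace.independent B" "W' \<subseteq> funspace.span B" "card B = funspace.dim W'"
    using funspace.basis_exists by blast
  obtain w where w: "w \<in> W" "w \<notin> W'" using assms by blast
  have "funspace.span B \<subseteq> W'"
    using B(1) assms(1) by (rule funspace.span_minimal)
  then have "w \<notin> funspace.span B" using w by blast
  then have ind: "funspace.independent (insert w B)" and wB: "w \<notin> B"
    using funspace.independent_insertI[of w B] B(2) funspace.span_base[of w B] by blast+
  have "insert w B \<subseteq> W" using B(1) w(1) assms(2) by blast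
  from card_le_dim[OF ind this assms(3,4)] show ?thesis using B(4) wB by auto
qed

definition algebra_act ::
  "nat \<Rightarrow> ((nat \<Rightarrow> nat) \<Rightarrow> ('x \<Rightarrow> 'k) \<Rightarrow> ('x \<Rightarrow> 'k)) \<Rightarrow> ((nat \<Rightarrow> nat) \<Rightarrow> 'k::field) \<Rightarrow> ('x \<Rightarrow> 'k) \<Rightarrow> ('x \<Rightarrow> 'k)"
  where "algebra_act n act y x = (\<Sum>g | g permutes {..<n}. fun_scale (y g) (act g x))"

locale symmetric_action =
  fixes n :: nat and act :: "(nat \<Rightarrow> nat) \<Rightarrow> ('x \<Rightarrow> 'k::field_char_0) \<Rightarrow> ('x \<Rightarrow> 'k)"
  assumes act_add: "act \<sigma> (x + y) = act \<sigma> x + act \<sigma> y"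
    and act_scale: "act \<sigma> (fun_scale c x) = fun_scale c (act \<sigma> x)"
    and act_comp: "\<sigma> permutes {..<n} \<Longrightarrow> \<tau> permutes {..<n} \<Longrightarrow> act (\<sigma> \<circ> \<tau>) x = act \<sigma> (act \<tau> x)"
    and act_id: "act id x = x"
begin

lemma act_zero: "act \<sigma> 0 = 0"
  using act_scale[of \<sigma> 0 0] by simp

lemma act_sum: "act \<sigma> (\<Sum>i\<in>I. f i) = (\<Sum>i\<in>I. act \<sigma> (f i))"
  using sum_comp_morphism[of "act \<sigma>" f I, OF act_zero act_add] unfolding o_def by (rule sym)

lemma act_inverse:
  assumes "\<sigma> permutes {..<n}"
  shows "act \<sigma> (act (inv_into UNIV \<sigma>) x) = x" "act (inv_into UNIV \<sigma>) (act \<sigma> x) = x"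
  using act_comp[OF assms permutes_inv[OF assms]] act_comp[OF permutes_inv[OF assms] assms]
  by (auto simp: permutes_inv_o[OF assms] act_id)

lemma submodule_subspace: "submodule n act W \<Longrightarrow> funspace.subspace W"
  by (simp add: submodule_def)

lemma submodule_act: "submodule n act W \<Longrightarrow> \<sigma> permutes {..<n} \<Longrightarrow> w \<in> W \<Longrightarrow> act \<sigma> w \<in> W"
  by (simp add: submodule_def)

lemma submodule_cyclic: "submodule n act (cyclic_submodule n act t)"
proof -
  let ?G = "{act \<sigma> t | \<sigma>. \<sigma> permutes {..<n}}"
  have "act \<tau> w \<in> funspace.span ?G" if \<tau>: "\<tau> permutes {..<n}" and w: "w \<in> funspace.span ?G" for \<tau> w
    using w
  proof (induction rule: funspace.span_induct_alt)
    case base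
    show "act \<tau> 0 \<in> funspace.span ?G" by (simp add: act_zero funspace.span_zero)
  next
    case (step c x y)
    then obtain \<sigma> where \<sigma>: "\<sigma> permutes {..<n}" "x = act \<sigma> t" by blast
    have "act \<tau> x = act (\<tau> \<circ> \<sigma>) t" using \<sigma> \<tau> by (simp add: act_comp)
    moreover have "\<tau> \<circ> \<sigma> permutes {..<n}" using \<sigma> \<tau> by (simp add: permutes_compose)
    ultimately have "act \<tau> x \<in> funspace.span ?G" by (auto intro: funspace.span_base)
    then show "act \<tau> (fun_scale c x + y) \<in> funspace.span ?G"
      using step by (auto simp: act_add act_scale intro: funspace.span_add funspace.span_scale)
  qed
  then show ?thesis
    by (auto simp: submodule_def cyclic_submodule_def)
qed

lemma cyclic_submodule_minimal:
  assumes "submodule n act W" "t \<in> W"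
  shows "cyclic_submodule n act t \<subseteq> W"
  unfolding cyclic_submodule_def
  by (rule funspace.span_minimal) (use assms in \<open>auto simp: submodule_def\<close>)

lemma generator_in_cyclic: "t \<in> cyclic_submodule n act t"
proof -
  have "act id t \<in> cyclic_submodule n act t"
    unfolding cyclic_submodule_def by (rule funspace.span_base) (use permutes_id in blast)
  then show ?thesis by (simp add: act_id)
qed

text \<open>
  Maschke's theorem: a linear projection onto \<open>N\<close>, averaged over the group, becomes equivariant,
  and its kernel is the complement.
\<close>

lemma maschke:
  assumes V: "submodule n act V" and N: "submodule n act N" and NV: "N \<subseteq> V"
  obtains N' where "submodule n act N'" "N' \<subseteq> V" "N \<inter> N' = {0}"
    "\<And>v. v \<in> V \<Longrightarrow> \<exists>x\<in>N. \<exists>y\<in>N'. v = x + y"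
proof -
  note sV = submodule_subspace[OF V] and sN = submodule_subspace[OF N]
  let ?G = "{\<sigma>. \<sigma> permutes {..<n}}"
  have "Vector_Spaces.linear fun_scale fun_scale (id :: ('x \<Rightarrow> 'k) \<Rightarrow> _)"
    by (rule funspace.linear_id)
  from funspace_pair.linear_exists_left_inverse_on[OF this sN]
  obtain \<pi> where \<pi>: "range \<pi> \<subseteq> N" "Vector_Spaces.linear fun_scale fun_scale \<pi>" "\<And>v. v \<in> N \<Longrightarrow> \<pi> v = v"
    by auto
  interpret \<pi>: Vector_Spaces.linear fun_scale fun_scale \<pi> by (rule \<pi>(2))
  define P where "P x = (\<Sum>\<sigma>\<in>?G. act \<sigma> (\<pi> (act (inv_into UNIV \<sigma>) x)))" for x
  define M where "M = (of_nat (card ?G) :: 'k)"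
  have "finite ?G" "id \<in> ?G" by (simp_all add: finite_permutations permutes_id)
  then have M0: "M \<noteq> 0" unfolding M_def by (metis card_0_eq empty_iff of_nat_eq_0_iff)
  have P_add: "P (x + y) = P x + P y" for x y
    by (simp add: P_def act_add \<pi>.add sum.distrib)
  have P_scale: "P (fun_scale a x) = fun_scale a (P x)" for a x
    by (simp add: P_def act_scale \<pi>.scale funspace.scale_sum_right)
  have P_in: "P x \<in> N" for x
    unfolding P_def by (rule funspace.subspace_sum[OF sN]) (use N \<pi>(1) in \<open>auto simp: submodule_def\<close>)
  have P_on: "P x = fun_scale M x" if "x \<in> N" for x
  proof -
    have "act \<sigma> (\<pi> (act (inv_into UNIV \<sigma>) x)) = x" if "\<sigma> \<in> ?G" for \<sigma>
      using that \<open>x \<in> N\<close> N by (simp add: \<pi>(3) submodule_act permutes_inv act_inverse)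
    then have "P x = (\<Sum>\<sigma>\<in>?G. x)" unfolding P_def by (rule sum.cong[OF refl])
    then show ?thesis by (auto simp: M_def fun_scale_def sum_fun_apply fun_eq_iff)
  qed
  have P_act: "P (act \<tau> x) = act \<tau> (P x)" if \<tau>: "\<tau> permutes {..<n}" for \<tau> x
  proof -
    have "P (act \<tau> x) = (\<Sum>\<sigma>\<in>?G. act (\<tau> \<circ> \<sigma>) (\<pi> (act (inv_into UNIV (\<tau> \<circ> \<sigma>)) (act \<tau> x))))"
      unfolding P_def by (rule setum_permutations_compose_left[OF \<tau>])
    also have "\<dots> = (\<Sum>\<sigma>\<in>?G. act \<tau> (act \<sigma> (\<pi> (act (inv_into UNIV \<sigma>) x))))"
    proof (rule sum.cong[OF refl])
      fix \<sigma> assume "\<sigma> \<in> ?G"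
      then have \<sigma>: "\<sigma> permutes {..<n}" by simp
      have "inv_into UNIV (\<tau> \<circ> \<sigma>) = inv_into UNIV \<sigma> \<circ> inv_into UNIV \<tau>"
        using \<sigma> \<tau> by (simp add: o_inv_distrib permutes_bij)
      then show "act (\<tau> \<circ> \<sigma>) (\<pi> (act (inv_into UNIV (\<tau> \<circ> \<sigma>)) (act \<tau> x))) = act \<tau> (act \<sigma> (\<pi> (act (inv_into UNIV \<sigma>) x)))"
        using \<sigma> \<tau> by (simp add: act_comp permutes_inv act_inverse)
    qed
    finally show ?thesis by (simp add: P_def act_sum)
  qed
  have P0: "P 0 = 0" using P_scale[of 0 0] by simp
  define N' where "N' = {v \<in> V. P v = 0}"
  show ?thesis
  proof
    show "submodule n act N'"
      unfolding submodule_def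
    proof (intro conjI allI impI ballI)
      show "funspace.subspace N'"
        by (rule funspace.subspaceI)
          (auto simp: N'_def P0 P_add P_scale funspace.subspace_0[OF sV] funspace.subspace_add[OF sV]
            funspace.subspace_scale[OF sV])
      fix \<tau> w assume "\<tau> permutes {..<n}" "w \<in> N'"
      then show "act \<tau> w \<in> N'" using V by (auto simp: N'_def P_act act_zero submodule_act)
    qed
    show "N' \<subseteq> V" by (auto simp: N'_def)
    show "N \<inter> N' = {0}"
    proof -
      have "x = 0" if "x \<in> N" "x \<in> N'" for x
        using that P_on[of x] M0 by (auto simp: N'_def)
      then show ?thesis
        by (auto simp: N'_def P0 funspace.subspace_0[OF sV] funspace.subspace_0[OF sN])
    qed
    fix v assume v: "v \<in> V"
    let ?x = "fun_scale (1 / M) (P v)"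
    have x: "?x \<in> N" by (rule funspace.subspace_scale[OF sN P_in])
    have "P ?x = P v" using P_on[OF x] M0 by simp
    moreover have "P (?x + (v - ?x)) = P ?x + P (v - ?x)" by (rule P_add)
    ultimately have "P (v - ?x) = 0" by simp
    then have "v - ?x \<in> N'"
      using v x NV by (auto simp: N'_def intro: funspace.subspace_diff[OF sV])
    then show "\<exists>x\<in>N. \<exists>y\<in>N'. v = x + y"
      using x by (intro bexI[of _ ?x] bexI[of _ "v - ?x"]) auto
  qed
qed

text \<open>
  A nonzero submodule of least dimension is irreducible; it splits off with a complement of
  smaller dimension.
\<close>

lemma irreducible_decomposition_exists:
  assumes "submodule n act W" "W \<subseteq> funspace.span F" "finite F"
  shows "\<exists>l U. irreducible_decomposition n act W l U"
  using assms(1,2)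
proof (induction "funspace.dim W" arbitrary: W rule: less_induct)
  case less
  note W = less.prems(1)
  note sW = submodule_subspace[OF W]
  show ?case
  proof (cases "W = {0}")
    case True
    then have "irreducible_decomposition n act W 0 (\<lambda>_. {})"
      by (auto simp: irreducible_decomposition_def)
    then show ?thesis by (intro exI[of _ 0] exI[of _ "\<lambda>_. {}"])
  next
    case False
    \<comment> \<open>candidates for the first irreducible summand\<close>
    define Q where "Q U \<longleftrightarrow> submodule n act U \<and> U \<noteq> {0} \<and> U \<subseteq> W" for U
    have "Q W" using False W by (simp add: Q_def)
    then obtain U where U: "Q U" and U_min: "\<And>U'. Q U' \<Longrightarrow> funspace.dim U \<le> funspace.dim U'"
      using ex_has_least_nat[of Q W funspace.dim] by blast
    have sU: "funspace.subspace U" using U by (auto simp: Q_def submodule_subspace)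
    have "irreducible_module n act U"
      unfolding irreducible_module_def
    proof (intro conjI allI impI)
      fix U' assume U': "submodule n act U' \<and> U' \<subseteq> U"
      show "U' = {0} \<or> U' = U"
      proof (rule ccontr)
        assume "\<not> (U' = {0} \<or> U' = U)"
        then have "Q U'" "U' \<subset> U" using U' U by (auto simp: Q_def)
        moreover have "funspace.dim U' < funspace.dim U"
          by (rule dim_less[of _ _ F]) (use U U' \<open>U' \<subset> U\<close> less.prems assms(3) in \<open>auto simp: Q_def submodule_subspace\<close>)
        ultimately show False using U_min by fastforce
      qed
    qed (use U in \<open>auto simp: Q_def\<close>)
    note irr = this
    obtain W' where W': "submodule n act W'" "W' \<subseteq> W" "U \<inter> W' = {0}"
      and dec: "\<And>v. v \<in> W \<Longrightarrow> \<exists>x\<in>U. \<exists>y\<in>W'. v = x + y"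
      using maschke[OF W, of U] U by (auto simp: Q_def)
    note sW' = submodule_subspace[OF W'(1)]
    have "W' \<noteq> W" using W' U by (auto simp: Q_def submodule_def funspace.subspace_0)
    then have "funspace.dim W' < funspace.dim W"
      using dim_less[of W' W F] W' sW' less.prems assms(3) by blast
    from less.hyps[OF this W'(1)] W'(2) less.prems(2)
    obtain l V where V: "irreducible_decomposition n act W' l V" by blast
    then have Vi: "irreducible_module n act (V i)" "V i \<subseteq> W'" if "i < l" for i
      using that by (auto simp: irreducible_decomposition_def)
    have Vu: "\<exists>!u. u \<in> (\<Pi>\<^sub>E i\<in>{..<l}. V i) \<and> w = (\<Sum>i<l. u i)" if "w \<in> W'" for w
      using that V by (auto simp: irreducible_decomposition_def)
    have "irreducible_decomposition n act W (Suc l) (V(l := U))"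
      unfolding irreducible_decomposition_def
    proof (intro conjI allI impI ballI)
      fix i assume "i < Suc l"
      then show "irreducible_module n act ((V(l := U)) i)" "(V(l := U)) i \<subseteq> W"
        using Vi irr W' U by (auto simp: Q_def less_Suc_eq)
    next
      fix w assume w: "w \<in> W"
      obtain x y where xy: "x \<in> U" "y \<in> W'" "w = x + y" using dec[OF w] by blast
      obtain u where u: "u \<in> (\<Pi>\<^sub>E i\<in>{..<l}. V i)" "y = (\<Sum>i<l. u i)" using Vu[OF xy(2)] by blast
      show "\<exists>!u. u \<in> (\<Pi>\<^sub>E i\<in>{..<Suc l}. (V(l := U)) i) \<and> w = (\<Sum>i<Suc l. u i)"
      proof (rule ex1I[of _ "u(l := x)"], intro conjI)
        show "u(l := x) \<in> (\<Pi>\<^sub>E i\<in>{..<Suc l}. (V(l := U)) i)"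
          using u(1) xy(1) by (auto simp: PiE_iff extensional_def less_Suc_eq)
        show "w = (\<Sum>i<Suc l. (u(l := x)) i)"
          using u(2) xy(3) by simp
      next
        fix u' assume u': "u' \<in> (\<Pi>\<^sub>E i\<in>{..<Suc l}. (V(l := U)) i) \<and> w = (\<Sum>i<Suc l. u' i)"
        let ?y = "\<Sum>i<l. u' i"
        have u'i: "u' i \<in> V i" if "i < l" for i
          using u' that by (auto simp: PiE_iff less_Suc_eq split: if_splits)
        have y': "?y \<in> W'"
          by (rule funspace.subspace_sum[OF sW']) (use u'i Vi(2) in auto)
        have x': "u' l \<in> U" using PiE_mem[OF conjunct1[OF u'], of l] by simp
        have eq: "x + y = u' l + ?y" using u' xy(3) by (simp add: add.commute)
        then have "x - u' l = ?y - y" by (simp add: algebra_simps)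
        moreover have "x - u' l \<in> U" using xy(1) x' by (rule funspace.subspace_diff[OF sU])
        moreover have "?y - y \<in> W'" using y' xy(2) by (rule funspace.subspace_diff[OF sW'])
        ultimately have "x - u' l \<in> U \<inter> W'" by (simp only: Int_iff)
        then have "x - u' l = 0" unfolding W'(3) by (rule singletonD)
        then have ul: "u' l = x" by (metis right_minus_eq)
        from eq have "x + y = x + ?y" unfolding ul .
        then have "y = ?y" by (rule add_left_imp_eq)
        then have "restrict u' {..<l} \<in> (\<Pi>\<^sub>E i\<in>{..<l}. V i) \<and> y = (\<Sum>i<l. restrict u' {..<l} i)"
          using u'i by (auto simp: PiE_iff)
        then have res: "restrict u' {..<l} = u" using Vu[OF xy(2)] u by blast
        show "u' = u(l := x)"
        proof
          fix i
          show "u' i = (u(l := x)) i"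
          proof (cases "i < l")
            case True
            then show ?thesis using fun_cong[OF res, of i] by simp
          next
            case False
            then show ?thesis
              using ul u' u(1) by (cases "i = l") (auto simp: PiE_iff extensional_def)
          qed
        qed
      qed
    qed
    then show ?thesis by (intro exI[of _ "Suc l"] exI[of _ "V(l := U)"])
  qed
qed

lemma algebra_act_add: "algebra_act n act y (x + x') = algebra_act n act y x + algebra_act n act y x'"
  by (simp add: algebra_act_def act_add funspace.scale_right_distrib sum.distrib)

lemma algebra_act_scale: "algebra_act n act y (fun_scale a x) = fun_scale a (algebra_act n act y x)"
  by (simp add: algebra_act_def act_scale funspace.scale_sum_right mult.commute)

lemma algebra_act_zero: "algebra_act n act y 0 = 0"
  using algebra_act_scale[of y 0 0] by simp

lemma algebra_act_sum: "algebra_act n act y (\<Sum>i\<in>I. f i) = (\<Sum>i\<in>I. algebra_act n act y (f i))"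
  using sum_comp_morphism[of "algebra_act n act y" f I, OF algebra_act_zero algebra_act_add]
  unfolding o_def by (rule sym)

lemma algebra_act_add_left: "algebra_act n act (y + y') x = algebra_act n act y x + algebra_act n act y' x"
  by (simp add: algebra_act_def funspace.scale_left_distrib sum.distrib)

lemma algebra_act_scale_left: "algebra_act n act (fun_scale a y) x = fun_scale a (algebra_act n act y x)"
  by (simp add: algebra_act_def funspace.scale_sum_right fun_scale_def[of a y])

lemma algebra_act_zero_left: "algebra_act n act 0 x = 0"
  using algebra_act_scale_left[of 0 0] by simp

lemma algebra_act_sum_left: "algebra_act n act (\<Sum>i\<in>I. f i) x = (\<Sum>i\<in>I. algebra_act n act (f i) x)"
  using sum_comp_morphism[of "\<lambda>y. algebra_act n act y x" f I, OF algebra_act_zero_left algebra_act_add_left]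
  unfolding o_def by (rule sym)

lemma algebra_act_in: "submodule n act W \<Longrightarrow> x \<in> W \<Longrightarrow> algebra_act n act y x \<in> W"
  unfolding algebra_act_def
  by (intro funspace.subspace_sum funspace.subspace_scale) (auto simp: submodule_subspace submodule_act)

lemma algebra_act_left_mult:
  assumes \<sigma>: "\<sigma> permutes {..<n}"
  shows "algebra_act n act (left_mult \<sigma> y) x = act \<sigma> (algebra_act n act y x)"
proof -
  have "algebra_act n act (left_mult \<sigma> y) x =
      (\<Sum>g | g permutes {..<n}. fun_scale (left_mult \<sigma> y (\<sigma> \<circ> g)) (act (\<sigma> \<circ> g) x))"
    unfolding algebra_act_def by (rule setum_permutations_compose_left[OF \<sigma>])
  also have "\<dots> = (\<Sum>g | g permutes {..<n}. act \<sigma> (fun_scale (y g) (act g x)))"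
    by (rule sum.cong)
      (auto simp: left_mult_def o_assoc permutes_inv_o[OF \<sigma>] act_comp[OF \<sigma>] act_scale)
  finally show ?thesis by (simp add: algebra_act_def act_sum)
qed

lemma algebra_act_assoc:
  "algebra_act n act c (algebra_act n act y x) = algebra_act n act (algebra_act n left_mult c y) x"
  by (simp add: algebra_act_def[of n act c] algebra_act_def[of n left_mult c] algebra_act_sum_left
      algebra_act_scale_left algebra_act_left_mult)

end

lemma symmetric_action_left_mult:
  "symmetric_action n (left_mult :: _ \<Rightarrow> ((nat \<Rightarrow> nat) \<Rightarrow> 'k::field_char_0) \<Rightarrow> _)"
proof
  fix \<sigma> \<tau> :: "nat \<Rightarrow> nat" and x :: "(nat \<Rightarrow> nat) \<Rightarrow> 'k"
  assume "\<sigma> permutes {..<n}" "\<tau> permutes {..<n}"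
  then show "left_mult (\<sigma> \<circ> \<tau>) x = left_mult \<sigma> (left_mult \<tau> x)"
    by (simp add: left_mult_def o_inv_distrib permutes_bij o_assoc)
qed (auto simp: left_mult_def fun_scale_def)

lemma symmetric_action_permute_factors:
  "symmetric_action n (permute_factors :: _ \<Rightarrow> ((nat \<Rightarrow> nat) \<Rightarrow> 'k::field_char_0) \<Rightarrow> _)"
  by unfold_locales (auto simp: permute_factors_def fun_scale_def o_assoc)


section \<open>Multiplicities from a primitive element\<close>

lemma family_independent:
  fixes z :: "'i \<Rightarrow> 'x \<Rightarrow> 'k::field"
  assumes fin: "finite J"
    and zero: "\<And>a i. (\<Sum>i\<in>J. fun_scale (a i) (z i)) = 0 \<Longrightarrow> i \<in> J \<Longrightarrow> a i = 0"
  shows "inj_on z J" "funspace.independent (z ` J)"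
proof -
  show inj: "inj_on z J"
  proof (rule inj_onI, rule ccontr)
    fix i j assume ij: "i \<in> J" "j \<in> J" "z i = z j" "i \<noteq> j"
    let ?a = "\<lambda>x. (if x = i then 1 else 0) - (if x = j then 1 else 0) :: 'k"
    have "(\<Sum>x\<in>J. fun_scale (?a x) (z x)) =
        (\<Sum>x\<in>J. (if x = i then z x else 0) - (if x = j then z x else 0))"
      by (rule sum.cong) (auto simp: fun_scale_def fun_eq_iff)
    also have "\<dots> = 0"
      using ij fin by (simp add: sum_subtractf)
    finally have "?a i = 0" using ij(1) by (rule zero)
    then show False using ij(4) by simp
  qed
  show "funspace.independent (z ` J)"
  proof (rule funspace.independent_if_scalars_zero)
    fix f x assume "(\<Sum>x\<in>z ` J. fun_scale (f x) x) = 0" "x \<in> z ` J"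
    moreover from this obtain i where "i \<in> J" "x = z i" by blast
    ultimately show "f x = 0"
      using zero[of "f \<circ> z" i] by (simp add: sum.reindex[OF inj])
  qed (use fin in simp)
qed

text \<open>
  The condition \<open>sandwich\<close> says that \<open>c \<cdot> kG \<cdot> c\<close> lies in the line spanned by \<open>c\<close>, as it does for
  a primitive idempotent of a matrix algebra. Together with semisimplicity it makes the left ideal
  of \<open>c\<close> irreducible and \<open>dim c\<cdot>W\<close> its multiplicity in \<open>W\<close>.
\<close>

locale primitive_element =
  fixes n :: nat and c :: "(nat \<Rightarrow> nat) \<Rightarrow> 'k::field_char_0"
  assumes support: "\<not> g permutes {..<n} \<Longrightarrow> c g = 0"
    and nonzero: "c \<noteq> 0"
    and sandwich: "\<sigma> permutes {..<n} \<Longrightarrow> \<exists>a. algebra_act n left_mult c (left_mult \<sigma> c) = fun_scale a c"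
begin

sublocale regular: symmetric_action n "left_mult :: _ \<Rightarrow> ((nat \<Rightarrow> nat) \<Rightarrow> 'k) \<Rightarrow> _"
  by (rule symmetric_action_left_mult)

abbreviation left_ideal where "left_ideal \<equiv> cyclic_submodule n left_mult c"

lemma sandwich_left_ideal:
  assumes "y \<in> left_ideal"
  shows "\<exists>a. algebra_act n left_mult c y = fun_scale a c"
  using assms unfolding cyclic_submodule_def
proof (induction rule: funspace.span_induct_alt)
  case base
  have "algebra_act n left_mult c 0 = fun_scale 0 c"
    by (simp add: regular.algebra_act_zero)
  then show "\<exists>a. algebra_act n left_mult c 0 = fun_scale a c" by (intro exI[of _ 0])
next
  case (step b x y)
  then obtain a \<sigma> a' where a: "algebra_act n left_mult c y = fun_scale a c"
    and \<sigma>: "\<sigma> permutes {..<n}" "x = left_mult \<sigma> c"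
    and a': "algebra_act n left_mult c x = fun_scale a' c"
    using sandwich by blast
  have "algebra_act n left_mult c (fun_scale b x + y) = fun_scale (b * a' + a) c"
    by (simp add: regular.algebra_act_add regular.algebra_act_scale a a' funspace.scale_left_distrib)
  then show "\<exists>a. algebra_act n left_mult c (fun_scale b x + y) = fun_scale a c"
    by (intro exI[of _ "b * a' + a"])
qed

text \<open>
  The component in the left ideal of the unit of the group algebra, along a complementary left
  ideal, is a right unit for \<open>c\<close>. Thus \<open>c\<close> does not annihilate its left ideal.
\<close>

lemma right_unit: "\<exists>e\<in>left_ideal. algebra_act n left_mult c e = c"
proof -
  let ?d = "(\<lambda>g. if g = id then 1 else 0) :: (nat \<Rightarrow> nat) \<Rightarrow> 'k"
  have d: "algebra_act n left_mult c ?d = c"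
  proof
    fix h
    have "algebra_act n left_mult c ?d h = (\<Sum>g | g permutes {..<n}. if g = h then c g else 0)"
      unfolding algebra_act_def sum_fun_apply
    proof (rule sum.cong[OF refl])
      fix g assume "g \<in> {g. g permutes {..<n}}"
      then have g: "bij g" by (simp add: permutes_bij)
      have "inv_into UNIV g \<circ> h = id \<longleftrightarrow> g = h"
      proof
        assume "inv_into UNIV g \<circ> h = id"
        then have "g \<circ> (inv_into UNIV g \<circ> h) = g" by simp
        then show "g = h" using g by (simp add: o_assoc bij_is_surj surj_iff[THEN iffD1])
      qed (use g in \<open>auto simp: bij_is_inj\<close>)
      then show "fun_scale (c g) (left_mult g ?d) h = (if g = h then c g else 0)"
        by (simp add: fun_scale_def left_mult_def)
    qed
    also have "\<dots> = c h"
      using support[of h] by (simp add: finite_permutations)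
    finally show "algebra_act n left_mult c ?d h = c h" .
  qed
  have L: "submodule n left_mult left_ideal" by (rule regular.submodule_cyclic)
  have "submodule n left_mult (UNIV :: ((nat \<Rightarrow> nat) \<Rightarrow> 'k) set)"
    by (simp add: submodule_def)
  from regular.maschke[OF this L subset_UNIV] obtain L' where
    L': "submodule n left_mult L'" "left_ideal \<inter> L' = {0}"
    and dec: "\<And>v. v \<in> UNIV \<Longrightarrow> \<exists>x\<in>left_ideal. \<exists>y\<in>L'. v = x + y"
    by metis
  obtain e e' where e: "e \<in> left_ideal" "e' \<in> L'" "?d = e + e'"
    using dec[of ?d] by blast
  let ?c = "algebra_act n left_mult c"
  have "c = ?c e + ?c e'"
    using d unfolding e(3) by (simp add: regular.algebra_act_add)
  then have "?c e' = c - ?c e" by (simp add: algebra_simps)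
  moreover have "c - ?c e \<in> left_ideal"
    using regular.generator_in_cyclic regular.algebra_act_in[OF L e(1)]
    by (intro funspace.subspace_diff regular.submodule_subspace[OF L]) auto
  moreover have "?c e' \<in> L'" using L'(1) e(2) by (rule regular.algebra_act_in)
  ultimately have "c - ?c e \<in> {0}" unfolding L'(2)[symmetric] by simp
  then have "?c e = c" by simp
  then show ?thesis using e(1) by (intro bexI[of _ e])
qed

text \<open>
  A submodule on which \<open>c\<close> does not vanish contains a nonzero multiple of \<open>c\<close>, hence everything. If
  \<open>c\<close> vanishes on \<open>N\<close>, then it does not vanish on a complement of \<open>N\<close>, because of the right unit; so
  the complement is everything.
\<close>

lemma irreducible_left_ideal: "irreducible_module n left_mult left_ideal"
  unfolding irreducible_module_def
proof (intro conjI allI impI)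
  show L: "submodule n left_mult left_ideal" by (rule regular.submodule_cyclic)
  show "left_ideal \<noteq> {0}" using nonzero regular.generator_in_cyclic by blast
  let ?c = "algebra_act n left_mult c"
  have eq: "N = left_ideal"
    if N: "submodule n left_mult N" "N \<subseteq> left_ideal" and y: "y \<in> N" "?c y \<noteq> 0" for N y
  proof -
    obtain a where a: "?c y = fun_scale a c"
      using sandwich_left_ideal y N by blast
    then have "a \<noteq> 0" using y(2) by auto
    have "fun_scale (1 / a) (?c y) \<in> N"
      using N(1) y(1) by (intro funspace.subspace_scale regular.submodule_subspace regular.algebra_act_in)
    then have "c \<in> N" using a \<open>a \<noteq> 0\<close> by simp
    then show ?thesis using regular.cyclic_submodule_minimal[OF N(1)] N(2) by blast
  qed
  fix N assume "submodule n left_mult N \<and> N \<subseteq> left_ideal"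
  then have N: "submodule n left_mult N" "N \<subseteq> left_ideal" by auto
  show "N = {0} \<or> N = left_ideal"
  proof (cases "\<exists>y\<in>N. ?c y \<noteq> 0")
    case True
    then show ?thesis using eq[OF N] by auto
  next
    case False
    obtain N' where N': "submodule n left_mult N'" "N' \<subseteq> left_ideal" "N \<inter> N' = {0}"
      and dec: "\<And>v. v \<in> left_ideal \<Longrightarrow> \<exists>x\<in>N. \<exists>y\<in>N'. v = x + y"
      using regular.maschke[OF L N] by metis
    obtain e where e: "e \<in> left_ideal" "?c e = c" using right_unit by blast
    obtain x y where xy: "x \<in> N" "y \<in> N'" "e = x + y" using dec[OF e(1)] by blast
    have "?c e = ?c x + ?c y" using xy(3) by (simp add: regular.algebra_act_add)
    then have "?c y \<noteq> 0" using e(2) False xy(1) nonzero by auto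
    then have "N' = left_ideal" using eq[OF N'(1,2) xy(2)] by blast
    then have "N \<inter> left_ideal = {0}" using N'(3) by simp
    then show ?thesis using N(2) by (simp add: Int_absorb2)
  qed
qed

end

locale primitive_element_action = symmetric_action n act + primitive_element n c
  for n :: nat and act :: "(nat \<Rightarrow> nat) \<Rightarrow> ('x \<Rightarrow> 'k::field_char_0) \<Rightarrow> ('x \<Rightarrow> 'k)"
    and c :: "(nat \<Rightarrow> nat) \<Rightarrow> 'k"
begin

text \<open>
  The orbit map \<open>y \<mapsto> y \<cdot> u\<close> is a homomorphism, and \<open>c\<close> goes to \<open>c \<cdot> u \<noteq> 0\<close>; so its image is all
  of \<open>U\<close>.
\<close>

lemma left_ideal_image:
  assumes U: "irreducible_module n act U" and u: "u \<in> U" and cu: "algebra_act n act c u \<noteq> 0"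
  shows "(\<lambda>y. algebra_act n act y u) ` left_ideal = U"
proof -
  let ?\<phi> = "\<lambda>y. algebra_act n act y u"
  have sU: "submodule n act U" using U by (simp add: irreducible_module_def)
  have L: "submodule n left_mult left_ideal" by (rule regular.submodule_cyclic)
  note sL = regular.submodule_subspace[OF L]
  have "submodule n act (?\<phi> ` left_ideal)"
    unfolding submodule_def
  proof (intro conjI allI impI ballI)
    show "funspace.subspace (?\<phi> ` left_ideal)"
    proof (rule funspace.subspaceI)
      show "0 \<in> ?\<phi> ` left_ideal"
        using funspace.subspace_0[OF sL] algebra_act_zero_left by (metis image_eqI)
    next
      fix x y assume "x \<in> ?\<phi> ` left_ideal" "y \<in> ?\<phi> ` left_ideal"
      then obtain a b where "a \<in> left_ideal" "b \<in> left_ideal" "x = ?\<phi> a" "y = ?\<phi> b" by blast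
      then have "x + y = ?\<phi> (a + b)" "a + b \<in> left_ideal"
        by (simp_all add: algebra_act_add_left funspace.subspace_add[OF sL])
      then show "x + y \<in> ?\<phi> ` left_ideal" by blast
    next
      fix b x assume "x \<in> ?\<phi> ` left_ideal"
      then obtain a where "a \<in> left_ideal" "x = ?\<phi> a" by blast
      then have "fun_scale b x = ?\<phi> (fun_scale b a)" "fun_scale b a \<in> left_ideal"
        by (simp_all add: algebra_act_scale_left funspace.subspace_scale[OF sL])
      then show "fun_scale b x \<in> ?\<phi> ` left_ideal" by blast
    qed
    fix \<sigma> w assume \<sigma>: "\<sigma> permutes {..<n}" and "w \<in> ?\<phi> ` left_ideal"
    then obtain a where "a \<in> left_ideal" "w = ?\<phi> a" by blast
    then have "act \<sigma> w = ?\<phi> (left_mult \<sigma> a)" "left_mult \<sigma> a \<in> left_ideal"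
      using \<sigma> L by (simp_all add: algebra_act_left_mult regular.submodule_act)
    then show "act \<sigma> w \<in> ?\<phi> ` left_ideal" by blast
  qed
  moreover have "?\<phi> ` left_ideal \<subseteq> U" using sU u by (auto intro: algebra_act_in)
  moreover have "?\<phi> ` left_ideal \<noteq> {0}"
    using cu regular.generator_in_cyclic by blast
  moreover have "W' = {0} \<or> W' = U" if "submodule n act W'" "W' \<subseteq> U" for W'
    using U that by (simp add: irreducible_module_def)
  ultimately show ?thesis by metis
qed

text \<open>
  Write \<open>w = y \<cdot> u\<close> with \<open>y\<close> in the left ideal; then \<open>c \<cdot> y\<close> is a multiple of \<open>c\<close>.
\<close>

lemma action_image_line:
  assumes U: "irreducible_module n act U" and u: "u \<in> U" "algebra_act n act c u \<noteq> 0" and w: "w \<in> U"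
  shows "\<exists>a. algebra_act n act c w = fun_scale a (algebra_act n act c u)"
proof -
  obtain y where y: "y \<in> left_ideal" "w = algebra_act n act y u"
    using left_ideal_image[OF U u] w by blast
  obtain a where "algebra_act n left_mult c y = fun_scale a c"
    using sandwich_left_ideal[OF y(1)] by blast
  then have "algebra_act n act c w = fun_scale a (algebra_act n act c u)"
    by (simp add: y(2) algebra_act_assoc algebra_act_scale_left)
  then show ?thesis by (intro exI[of _ a])
qed

text \<open>
  The right unit goes through any isomorphism to an element on which \<open>c\<close> does not vanish.
  Conversely, the orbit map of such an element is an isomorphism by Schur's lemma.
\<close>

lemma isomorphic_left_ideal_iff:
  assumes U: "irreducible_module n act U"
  shows "isomorphic_modules n act U left_mult left_ideal \<longleftrightarrow> (\<exists>u\<in>U. algebra_act n act c u \<noteq> 0)"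
proof
  have sU: "submodule n act U" using U by (simp add: irreducible_module_def)
  assume "isomorphic_modules n act U left_mult left_ideal"
  then obtain f where f: "bij_betw f U left_ideal"
    "\<And>x y. x \<in> U \<Longrightarrow> y \<in> U \<Longrightarrow> f (x + y) = f x + f y"
    "\<And>a x. x \<in> U \<Longrightarrow> f (fun_scale a x) = fun_scale a (f x)"
    "\<And>\<sigma> x. \<sigma> permutes {..<n} \<Longrightarrow> x \<in> U \<Longrightarrow> f (act \<sigma> x) = left_mult \<sigma> (f x)"
    unfolding isomorphic_modules_def by blast
  note ssU = submodule_subspace[OF sU]
  have f0: "f 0 = 0" using f(3)[OF funspace.subspace_0[OF ssU], of 0] by simp
  have f_sum: "f (\<Sum>i\<in>I. h i) = (\<Sum>i\<in>I. f (h i))" if "finite I" "\<And>i. i \<in> I \<Longrightarrow> h i \<in> U" for I :: "(nat \<Rightarrow> nat) set" and h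
    using that
  proof (induction I rule: finite_induct)
    case empty
    show "f (\<Sum>i\<in>{}. h i) = (\<Sum>i\<in>{}. f (h i))" by (simp add: f0)
  next
    case (insert x F)
    then have "f (h x + (\<Sum>i\<in>F. h i)) = f (h x) + f (\<Sum>i\<in>F. h i)"
      by (intro f(2) funspace.subspace_sum[OF ssU]) auto
    then show "f (\<Sum>i\<in>insert x F. h i) = (\<Sum>i\<in>insert x F. f (h i))" using insert by simp
  qed
  have f_alg: "f (algebra_act n act c u) = algebra_act n left_mult c (f u)" if "u \<in> U" for u
    unfolding algebra_act_def
    by (subst f_sum)
      (use that sU in \<open>auto simp: f(3,4) finite_permutations submodule_act intro!: sum.cong funspace.subspace_scale[OF ssU]\<close>)
  obtain e where e: "e \<in> left_ideal" "algebra_act n left_mult c e = c" using right_unit by blast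
  obtain u where u: "u \<in> U" "e = f u" using e(1) f(1) by (auto simp: bij_betw_def)
  have "algebra_act n act c u \<noteq> 0"
    using f_alg[OF u(1)] e(2) u(2) f0 nonzero by auto
  then show "\<exists>u\<in>U. algebra_act n act c u \<noteq> 0" using u(1) by (intro bexI[of _ u])
next
  have sU: "submodule n act U" using U by (simp add: irreducible_module_def)
  have L: "submodule n left_mult left_ideal" by (rule regular.submodule_cyclic)
  note sL = regular.submodule_subspace[OF L]
  assume "\<exists>u\<in>U. algebra_act n act c u \<noteq> 0"
  then obtain u where u: "u \<in> U" "algebra_act n act c u \<noteq> 0" by blast
  define \<phi> where "\<phi> y = algebra_act n act y u" for y
  have \<phi>_add: "\<phi> (x + y) = \<phi> x + \<phi> y" for x y by (simp add: \<phi>_def algebra_act_add_left)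
  have \<phi>_scale: "\<phi> (fun_scale a y) = fun_scale a (\<phi> y)" for a y by (simp add: \<phi>_def algebra_act_scale_left)
  have \<phi>_act: "\<sigma> permutes {..<n} \<Longrightarrow> \<phi> (left_mult \<sigma> y) = act \<sigma> (\<phi> y)" for \<sigma> y
    by (simp add: \<phi>_def algebra_act_left_mult)
  have \<phi>0: "\<phi> 0 = 0" by (simp add: \<phi>_def algebra_act_zero_left)
  have img: "\<phi> ` left_ideal = U" using left_ideal_image[OF U u] by (simp add: \<phi>_def[abs_def])
  let ?K = "{y \<in> left_ideal. \<phi> y = 0}"
  have "submodule n left_mult ?K"
    unfolding submodule_def
    by (auto simp: \<phi>_add \<phi>_scale \<phi>_act \<phi>0 act_zero funspace.subspace_0[OF sL] funspace.subspace_add[OF sL]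
        funspace.subspace_scale[OF sL] regular.submodule_act[OF L] intro!: funspace.subspaceI)
  moreover have "c \<notin> ?K" using u(2) by (simp add: \<phi>_def)
  ultimately have K: "?K = {0}"
    using irreducible_left_ideal regular.generator_in_cyclic[of c]
    unfolding irreducible_module_def by (metis (no_types, lifting) mem_Collect_eq subsetI)
  have inj: "inj_on \<phi> left_ideal"
  proof (rule inj_onI)
    fix x y assume xy: "x \<in> left_ideal" "y \<in> left_ideal" "\<phi> x = \<phi> y"
    have "\<phi> x = \<phi> (x - y) + \<phi> y" using \<phi>_add[of "x - y" y] by simp
    then have "x - y \<in> ?K" using xy funspace.subspace_diff[OF sL] by simp
    then show "x = y" using K by simp
  qed
  define f where "f = inv_into left_ideal \<phi>"
  have bij: "bij_betw \<phi> left_ideal U" using inj img by (simp add: bij_betw_def)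
  then have bij': "bij_betw f U left_ideal" unfolding f_def by (rule bij_betw_inv_into)
  have fL: "f x \<in> left_ideal" and \<phi>f: "\<phi> (f x) = x" if "x \<in> U" for x
    using that img unfolding f_def by (auto simp: inv_into_into f_inv_into_f)
  have f_eq: "f x = y" if "y \<in> left_ideal" "\<phi> y = x" for x y
    unfolding f_def using that inj by auto
  show "isomorphic_modules n act U left_mult left_ideal"
    unfolding isomorphic_modules_def
    using bij' fL \<phi>f
    by (intro exI[of _ f] conjI)
      (auto intro!: f_eq simp: \<phi>_add \<phi>_scale \<phi>_act funspace.subspace_add[OF sL]
        funspace.subspace_scale[OF sL] regular.submodule_act[OF L])
qed

text \<open>
  Applying \<open>c\<close> to the decomposition leaves one line for each summand isomorphic to the left ideal
  and nothing for the other summands.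
\<close>

lemma isomorphic_summands:
  assumes dec: "irreducible_decomposition n act W l U" and W: "submodule n act W"
  shows "card {i. i < l \<and> isomorphic_modules n act (U i) left_mult left_ideal} =
    funspace.dim (algebra_act n act c ` W)"
proof -
  let ?c = "algebra_act n act c"
  note sW = submodule_subspace[OF W]
  have Ui: "irreducible_module n act (U i)" "U i \<subseteq> W" if "i < l" for i
    using that dec by (auto simp: irreducible_decomposition_def)
  have ssU: "funspace.subspace (U i)" "submodule n act (U i)" if "i < l" for i
    using Ui(1)[OF that] by (auto simp: irreducible_module_def submodule_subspace)
  have Uu: "\<exists>!u. u \<in> (\<Pi>\<^sub>E i\<in>{..<l}. U i) \<and> w = (\<Sum>i<l. u i)" if "w \<in> W" for w
    using that dec by (auto simp: irreducible_decomposition_def)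
  define J where "J = {i. i < l \<and> isomorphic_modules n act (U i) left_mult left_ideal}"
  have J: "i \<in> J \<longleftrightarrow> i < l \<and> (\<exists>u\<in>U i. ?c u \<noteq> 0)" for i
    using Ui(1) by (auto simp: J_def isomorphic_left_ideal_iff)
  then have "\<forall>i\<in>J. \<exists>u. u \<in> U i \<and> ?c u \<noteq> 0" by blast
  then obtain b where b: "\<And>i. i \<in> J \<Longrightarrow> b i \<in> U i \<and> ?c (b i) \<noteq> 0" by metis
  define z where "z i = ?c (b i)" for i
  have fin: "finite J" by (simp add: J_def)
  have Jl: "i < l" if "i \<in> J" for i using that by (simp add: J_def)
  have zU: "z i \<in> U i" "z i \<noteq> 0" if "i \<in> J" for i
    using b[OF that] ssU(2)[OF Jl[OF that]] by (auto simp: z_def algebra_act_in)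
  have indep: "a i = 0" if eq: "(\<Sum>i\<in>J. fun_scale (a i) (z i)) = 0" and i: "i \<in> J" for a i
  proof -
    \<comment> \<open>the relation, completed by zeros, and the zero family are two decompositions of 0\<close>
    let ?u = "\<lambda>i\<in>{..<l}. if i \<in> J then fun_scale (a i) (z i) else 0"
    let ?v = "\<lambda>i\<in>{..<l}. 0 :: 'x \<Rightarrow> 'k"
    have "?u \<in> (\<Pi>\<^sub>E i\<in>{..<l}. U i)"
      using zU ssU(1) by (auto simp: funspace.subspace_scale funspace.subspace_0)
    moreover have "0 = (\<Sum>i<l. ?u i)"
    proof -
      have "(\<Sum>i<l. ?u i) = (\<Sum>i\<in>J. ?u i)"
        by (rule sum.mono_neutral_right) (auto dest: Jl)
      also have "\<dots> = (\<Sum>i\<in>J. fun_scale (a i) (z i))"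
        by (rule sum.cong) (auto dest: Jl)
      finally show ?thesis using eq by simp
    qed
    moreover have "?v \<in> (\<Pi>\<^sub>E i\<in>{..<l}. U i)" "0 = (\<Sum>i<l. ?v i)"
      using ssU(1) by (auto simp: funspace.subspace_0)
    ultimately have "?u = ?v"
      using Uu[OF funspace.subspace_0[OF sW]] by blast
    from fun_cong[OF this, of i] have "fun_scale (a i) (z i) = 0" using i Jl[OF i] by simp
    then show "a i = 0" using zU(2)[OF i] by simp
  qed
  have fam: "inj_on z J" "funspace.independent (z ` J)"
    by (rule family_independent[OF fin]; erule (1) indep)+
  have "funspace.dim (?c ` W) = card (z ` J)"
  proof (rule funspace.dim_unique[OF _ _ fam(2) refl])
    show "z ` J \<subseteq> ?c ` W" using b Jl Ui(2) by (fastforce simp: z_def)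
    show "?c ` W \<subseteq> funspace.span (z ` J)"
    proof
      fix x assume "x \<in> ?c ` W"
      then obtain w where w: "w \<in> W" "x = ?c w" by blast
      then obtain u where u: "u \<in> (\<Pi>\<^sub>E i\<in>{..<l}. U i)" "w = (\<Sum>i<l. u i)" using Uu by blast
      have "?c (u i) \<in> funspace.span (z ` J)" if il: "i < l" for i
      proof (cases "i \<in> J")
        case True
        have "u i \<in> U i" using u(1) il by auto
        then obtain a where "?c (u i) = fun_scale a (z i)"
          unfolding z_def using action_image_line[OF Ui(1)[OF il]] b[OF True] by metis
        then show ?thesis using True by (auto intro: funspace.span_scale funspace.span_base)
      next
        case False
        then have "?c (u i) = 0" using J[of i] u(1) il by auto
        then show ?thesis by (simp add: funspace.span_zero)
      qed
      then show "x \<in> funspace.span (z ` J)"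
        unfolding w(2) u(2) algebra_act_sum by (auto intro: funspace.span_sum)
    qed
  qed
  then show ?thesis using fam(1) by (simp add: card_image J_def)
qed

lemma multiplicity_eq_dim:
  assumes W: "submodule n act W" and F: "W \<subseteq> funspace.span F" "finite F"
  shows "module_multiplicity n left_mult left_ideal act W = funspace.dim (algebra_act n act c ` W)"
  unfolding module_multiplicity_def
proof (rule the_equality)
  obtain l U where U: "irreducible_decomposition n act W l U"
    using irreducible_decomposition_exists[OF W F] by (elim exE)
  then show "\<exists>l U. irreducible_decomposition n act W l U \<and> funspace.dim (algebra_act n act c ` W) =
      card {i. i < l \<and> isomorphic_modules n act (U i) left_mult left_ideal}"
    using isomorphic_summands[OF U W] by (intro exI[of _ l] exI[of _ U]) simp
qed (use isomorphic_summands[OF _ W] in auto)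

end


section \<open>The Young symmetrizer of a hook\<close>

lemma permutes_split:
  assumes h: "h permutes N" and B: "B \<subseteq> N" "h ` B = B"
  obtains h1 h2 where "h1 permutes B" "h2 permutes N - B" "h = h2 \<circ> h1"
proof
  have inj: "inj h" using h by (rule permutes_inj)
  have "h ` (N - B) = N - B"
    using B h by (simp add: image_set_diff inj permutes_image)
  moreover have "inj_on h (N - B)" "inj_on h B" using inj by (auto intro: inj_on_subset)
  ultimately show "restrict_id h B permutes B" "restrict_id h (N - B) permutes N - B"
    using B by (auto intro!: permutes_restrict_id simp: bij_betw_def)
  show "h = restrict_id h (N - B) \<circ> restrict_id h B"
  proof
    fix x
    have "h x \<in> B" if "x \<in> B" using B(2) that by blast
    moreover have "h x = x" if "x \<notin> N" using h that by (rule permutes_not_in)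
    ultimately show "h x = (restrict_id h (N - B) \<circ> restrict_id h B) x"
      by (auto simp: restrict_id_def)
  qed
qed

definition symmetrize :: "nat set \<Rightarrow> ((nat \<Rightarrow> nat) \<Rightarrow> 'k::field) \<Rightarrow> (nat \<Rightarrow> nat) \<Rightarrow> 'k" where
  "symmetrize S T = (\<lambda>w. \<Sum>p | p permutes S. T (w \<circ> p))"

definition alternate :: "nat set \<Rightarrow> ((nat \<Rightarrow> nat) \<Rightarrow> 'k::field) \<Rightarrow> (nat \<Rightarrow> nat) \<Rightarrow> 'k" where
  "alternate S T = (\<lambda>w. \<Sum>q | q permutes S. of_int (sign q) * T (w \<circ> q))"

text \<open>
  In the tableau of a hook only the first row and the first column have more than one entry, and
  they meet in the entry \<open>0\<close>. The row and column stabilizers are therefore the symmetric groups on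
  two sets with a single common element.
\<close>

locale hook_shape =
  fixes n k :: nat
  assumes k_pos: "1 \<le> k" and k_le: "k \<le> n"
begin

definition "first_row = {..<n + 1 - k}"
definition "first_col = insert 0 {n + 1 - k..<n}"

lemma finite_first_row [simp]: "finite first_row" and finite_first_col [simp]: "finite first_col"
  by (simp_all add: first_row_def first_col_def)

lemma first_row_subset: "first_row \<subseteq> {..<n}" and first_col_subset: "first_col \<subseteq> {..<n}"
  using k_pos k_le by (auto simp: first_row_def first_col_def)

lemma zero_in_first_row: "0 \<in> first_row" and zero_in_first_col: "0 \<in> first_col"
  using k_pos k_le by (auto simp: first_row_def first_col_def)

lemma col_eq: "first_col = insert 0 ({..<n} - first_row)"
  using k_pos k_le by (auto simp: first_row_def first_col_def)

lemma in_row_iff: "x < n \<Longrightarrow> x \<in> first_row \<longleftrightarrow> x = 0 \<or> x \<notin> first_col"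
  using zero_in_first_row by (auto simp: col_eq)

lemma card_first_col: "card first_col = k"
  using k_pos k_le by (simp add: first_col_def)

lemma card_first_row: "card first_row = n + 1 - k"
  by (simp add: first_row_def)

lemma length_hook: "length (hook n k) = k"
  using k_pos by (simp add: hook_def)

lemma hook_nth: "p < k \<Longrightarrow> hook n k ! p = (if p = 0 then n + 1 - k else 1)"
  by (cases p) (auto simp: hook_def)

lemma sum_list_take_hook:
  assumes "p < k"
  shows "sum_list (take p (hook n k)) = (if p = 0 then 0 else n - k + p)"
  using assms k_le by (cases p) (auto simp: hook_def sum_list_replicate)

lemma is_partition_hook: "is_partition n (hook n k)"
  using k_pos k_le
  by (auto simp: is_partition_def hook_def sorted_wrt_iff_nth_less sum_list_replicate nth_Cons')

lemma tab_row_hook: "p < k \<Longrightarrow> tab_row (hook n k) p = (if p = 0 then first_row else {n - k + p})"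
  by (auto simp: tab_row_def sum_list_take_hook hook_nth first_row_def)

lemma tab_col_hook: "tab_col (hook n k) c = (if c = 0 then first_col else if c \<in> first_row then {c} else {})"
proof -
  have "tab_col (hook n k) c = {(if p = 0 then 0 else n - k + p) + c | p. p < k \<and> c < (if p = 0 then n + 1 - k else 1)}"
    unfolding tab_col_def length_hook
    by (intro Collect_cong ex_cong1) (auto simp: sum_list_take_hook hook_nth)
  also have "\<dots> = (if c = 0 then first_col else if c \<in> first_row then {c} else {})"
  proof (cases "c = 0")
    case True
    show ?thesis
    proof (intro equalityI subsetI)
      fix x assume "x \<in> (if c = 0 then first_col else if c \<in> first_row then {c} else {})"
      then show "x \<in> {(if p = 0 then 0 else n - k + p) + c | p. p < k \<and> c < (if p = 0 then n + 1 - k else 1)}"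
        using True k_pos k_le
        by (cases "x = 0") (auto simp: first_col_def intro!: exI[of _ "x - (n - k)"])
    next
      fix x assume "x \<in> {(if p = 0 then 0 else n - k + p) + c | p. p < k \<and> c < (if p = 0 then n + 1 - k else 1)}"
      then obtain p where "p < k" "x = (if p = 0 then 0 else n - k + p)" using True by auto
      then show "x \<in> (if c = 0 then first_col else if c \<in> first_row then {c} else {})"
        using True k_pos k_le by (cases "p = 0") (auto simp: first_col_def)
    qed
  next
    case False
    then show ?thesis using k_pos by (auto simp: first_row_def)
  qed
  finally show ?thesis .
qed

lemma row_stabilizer_hook: "row_stabilizer n (hook n k) = {\<sigma>. \<sigma> permutes first_row}"
proof (intro equalityI subsetI CollectI)
  fix \<sigma> assume "\<sigma> \<in> row_stabilizer n (hook n k)"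
  then have \<sigma>: "\<sigma> permutes {..<n}" and st: "\<And>p. p < k \<Longrightarrow> \<sigma> ` tab_row (hook n k) p = tab_row (hook n k) p"
    by (auto simp: row_stabilizer_def length_hook)
  show "\<sigma> permutes first_row"
  proof (rule permutes_superset[OF \<sigma>])
    fix x assume x: "x \<in> {..<n} - first_row"
    then have "x - (n - k) < k" "x - (n - k) \<noteq> 0" "n - k + (x - (n - k)) = x"
      using k_le by (auto simp: first_row_def)
    then show "\<sigma> x = x" using st[of "x - (n - k)"] by (simp add: tab_row_hook)
  qed
next
  fix \<sigma> assume "\<sigma> \<in> {\<sigma>. \<sigma> permutes first_row}"
  then have \<sigma>: "\<sigma> permutes first_row" by simp
  have "\<sigma> ` tab_row (hook n k) p = tab_row (hook n k) p" if "p < k" for p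
  proof (cases "p = 0")
    case True
    then show ?thesis using that permutes_image[OF \<sigma>] by (simp add: tab_row_hook)
  next
    case False
    then have "n - k + p \<notin> first_row" by (auto simp: first_row_def)
    then show ?thesis using that False permutes_not_in[OF \<sigma>] by (simp add: tab_row_hook)
  qed
  then show "\<sigma> \<in> row_stabilizer n (hook n k)"
    using permutes_subset[OF \<sigma> first_row_subset] by (simp add: row_stabilizer_def length_hook)
qed

lemma col_stabilizer_hook: "col_stabilizer n (hook n k) = {\<sigma>. \<sigma> permutes first_col}"
proof (intro equalityI subsetI CollectI)
  fix \<sigma> assume "\<sigma> \<in> col_stabilizer n (hook n k)"
  then have \<sigma>: "\<sigma> permutes {..<n}" and st: "\<And>c. \<sigma> ` tab_col (hook n k) c = tab_col (hook n k) c"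
    by (auto simp: col_stabilizer_def)
  show "\<sigma> permutes first_col"
  proof (rule permutes_superset[OF \<sigma>])
    fix x assume x: "x \<in> {..<n} - first_col"
    then have "x \<noteq> 0" using zero_in_first_col by (metis DiffE)
    moreover from this x have "x \<in> first_row" by (simp add: in_row_iff)
    ultimately show "\<sigma> x = x" using st[of x] by (simp add: tab_col_hook)
  qed
next
  fix \<sigma> assume "\<sigma> \<in> {\<sigma>. \<sigma> permutes first_col}"
  then have \<sigma>: "\<sigma> permutes first_col" by simp
  have "\<sigma> ` tab_col (hook n k) c = tab_col (hook n k) c" for c
  proof (cases "c = 0")
    case True
    then show ?thesis using permutes_image[OF \<sigma>] by (simp add: tab_col_hook)
  next
    case False
    have "c \<notin> first_col" if "c \<in> first_row" using False that by (auto simp: col_eq)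
    then show ?thesis using False permutes_not_in[OF \<sigma>, of c] by (simp add: tab_col_hook)
  qed
  then show "\<sigma> \<in> col_stabilizer n (hook n k)"
    using permutes_subset[OF \<sigma> first_col_subset] by (simp add: col_stabilizer_def)
qed

abbreviation symmetrizer :: "(nat \<Rightarrow> nat) \<Rightarrow> 'k::field_char_0" where
  "symmetrizer \<equiv> young_symmetrizer n (hook n k)"

lemma symmetrizer_eq:
  "symmetrizer g = (\<Sum>p | p permutes first_row. \<Sum>q | q permutes first_col. if p \<circ> q = g then of_int (sign q) else 0)"
proof -
  let ?R = "{p. p permutes first_row}" and ?C = "{q. q permutes first_col}"
  have fin: "finite (?R \<times> ?C)" by (simp add: finite_permutations)
  have "symmetrizer g = (\<Sum>x\<in>{x \<in> ?R \<times> ?C. fst x \<circ> snd x = g}. of_int (sign (snd x)))"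
    unfolding young_symmetrizer_def row_stabilizer_hook col_stabilizer_hook
    by (rule sum.cong) auto
  also have "\<dots> = (\<Sum>x\<in>?R \<times> ?C. if fst x \<circ> snd x = g then of_int (sign (snd x)) else 0)"
    using fin by (rule sum.inter_filter)
  also have "\<dots> = (\<Sum>p\<in>?R. \<Sum>q\<in>?C. if p \<circ> q = g then of_int (sign q) else 0)"
    by (simp add: sum.cartesian_product case_prod_unfold)
  finally show ?thesis by simp
qed

lemma permutation_col: "q permutes first_col \<Longrightarrow> permutation q"
  using finite_first_col permutes_imp_permutation by blast

lemma symmetrizer_row_left:
  assumes p: "p permutes first_row"
  shows "symmetrizer (p \<circ> g) = symmetrizer g"
proof -
  have inj: "p \<circ> a = p \<circ> b \<longleftrightarrow> a = b" for a b :: "nat \<Rightarrow> nat"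
    using permutes_inj[OF p] by (auto simp: fun_eq_iff inj_eq)
  have "symmetrizer (p \<circ> g) =
      (\<Sum>p' | p' permutes first_row. \<Sum>q | q permutes first_col. if (p \<circ> p') \<circ> q = p \<circ> g then of_int (sign q) else 0)"
    unfolding symmetrizer_eq[of "p \<circ> g"] by (rule setum_permutations_compose_left[OF p])
  then show ?thesis by (simp add: o_assoc[symmetric] inj symmetrizer_eq[of g])
qed

lemma symmetrizer_col_right:
  assumes q: "q permutes first_col"
  shows "symmetrizer (g \<circ> q) = of_int (sign q) * symmetrizer g"
proof -
  have inj: "a \<circ> q = b \<circ> q \<longleftrightarrow> a = b" for a b :: "nat \<Rightarrow> nat"
    using permutes_surj[OF q] by (metis comp_apply ext surjD)
  have "symmetrizer (g \<circ> q) =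
      (\<Sum>p | p permutes first_row. \<Sum>q' | q' permutes first_col. if p \<circ> (q' \<circ> q) = g \<circ> q then of_int (sign (q' \<circ> q)) else 0)"
    unfolding symmetrizer_eq[of "g \<circ> q"] by (rule sum.cong[OF refl], rule sum_permutations_compose_right[OF q])
  also have "\<dots> = (\<Sum>p | p permutes first_row. \<Sum>q' | q' permutes first_col. of_int (sign q) * (if p \<circ> q' = g then of_int (sign q') else 0))"
    by (intro sum.cong refl) (auto simp: o_assoc inj sign_compose permutation_col q)
  finally show ?thesis by (simp add: symmetrizer_eq[of g] sum_distrib_left)
qed

lemma row_col_trivial:
  assumes p: "p permutes first_row" and q: "q permutes first_col"
  shows "p \<circ> q = id \<longleftrightarrow> p = id \<and> q = id"
proof
  assume pq: "p \<circ> q = id"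
  have fixed: "q x = x" if "x \<notin> first_row" for x
  proof -
    have "p (q x) = x" using pq by (metis comp_apply id_apply)
    moreover have "p x = x" using p that by (rule permutes_not_in)
    ultimately show ?thesis using permutes_inj[OF p] by (metis injD)
  qed
  \<comment> \<open>only 0 lies in both the first row and the first column\<close>
  have "q permutes {0}"
    by (rule permutes_superset[OF q]) (use fixed col_eq in auto)
  then have "q = id" by simp
  then show "p = id \<and> q = id" using pq by simp
qed simp

lemma symmetrizer_id: "symmetrizer id = 1"
proof -
  have "symmetrizer id = (\<Sum>p | p permutes first_row. \<Sum>q | q permutes first_col. if q = id then (if p = id then 1 else 0) else 0)"
    unfolding symmetrizer_eq by (intro sum.cong refl) (auto simp: row_col_trivial)
  also have "\<dots> = 1"
    by (simp add: finite_permutations permutes_id)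
  finally show ?thesis .
qed

lemma symmetrizer_support:
  assumes "\<not> g permutes {..<n}"
  shows "symmetrizer g = 0"
proof -
  have "p \<circ> q \<noteq> g" if "p permutes first_row" "q permutes first_col" for p q
    using assms permutes_compose[OF permutes_subset[OF that(2) first_col_subset] permutes_subset[OF that(1) first_row_subset]]
    by auto
  then show ?thesis by (auto simp: symmetrizer_eq intro!: sum.neutral)
qed

text \<open>
  Von Neumann's dichotomy. If \<open>g\<close> maps two entries of the column into the row, the transposition of
  these entries corresponds under \<open>g\<close> to a transposition inside the row. Otherwise, by counting,
  exactly one entry of the column goes into the row; a transposition of the row moves its image to
  \<open>0\<close>, after which the column is preserved.
\<close>

lemma double_coset:
  assumes g: "g permutes {..<n}"
  shows "(\<exists>p q. p permutes first_row \<and> q permutes first_col \<and> g = p \<circ> q) \<or>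
    (\<exists>t s. t permutes first_row \<and> s permutes first_col \<and> sign s = -1 \<and> t \<circ> g = g \<circ> s)"
proof (cases "\<exists>b\<in>first_col. \<exists>b'\<in>first_col. b \<noteq> b' \<and> g b \<in> first_row \<and> g b' \<in> first_row")
  case True
  then obtain b b' where b: "b \<in> first_col" "b' \<in> first_col" "b \<noteq> b'" "g b \<in> first_row" "g b' \<in> first_row" by blast
  have "transpose (g b) (g b') \<circ> g = g \<circ> transpose b b'"
    using permutes_inj[OF g] by (auto simp: fun_eq_iff transpose_def inj_eq)
  then have "transpose (g b) (g b') permutes first_row \<and> transpose b b' permutes first_col \<and> sign (transpose b b') = -1 \<and>
      transpose (g b) (g b') \<circ> g = g \<circ> transpose b b'"
    using b by (simp add: permutes_swap_id sign_swap_id)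
  then show ?thesis by metis
next
  case False
  have inj: "inj g" using g by (rule permutes_inj)
  have gc: "g ` first_col \<subseteq> {..<n}" "card (g ` first_col) = k"
    using first_col_subset permutes_image[OF g] card_first_col by (auto simp: card_image inj_on_subset[OF inj])
  have cc: "card ({..<n} - first_row) = k - 1"
    using k_pos k_le first_row_subset by (simp add: card_Diff_subset card_first_row)
  have "\<not> g ` first_col \<subseteq> {..<n} - first_row"
    using card_mono[of "{..<n} - first_row" "g ` first_col"] gc(2) cc k_pos by auto
  then obtain b where b: "b \<in> first_col" "g b \<in> first_row" using gc(1) by blast
  have "g ` first_col - {g b} \<subseteq> {..<n} - first_row"
  proof
    fix y assume "y \<in> g ` first_col - {g b}"
    then obtain b' where b': "b' \<in> first_col" "y = g b'" "g b' \<noteq> g b" by blast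
    then have "b \<noteq> b'" by auto
    then have "y \<notin> first_row" using False b b'(1,2) by metis
    then show "y \<in> {..<n} - first_row" using gc(1) b' by auto
  qed
  moreover have "card (g ` first_col - {g b}) = k - 1" using b gc(2) by simp
  ultimately have "g ` first_col - {g b} = {..<n} - first_row"
    using cc by (intro card_subset_eq) auto
  then have gcol: "g ` first_col = insert (g b) ({..<n} - first_row)" using b by blast
  define p where "p = transpose 0 (g b)"
  have p: "p permutes first_row" unfolding p_def using b zero_in_first_row by (simp add: permutes_swap_id)
  have pp: "p \<circ> p = id" by (simp add: p_def)
  have "(p \<circ> g) ` first_col = p ` insert (g b) ({..<n} - first_row)"
    unfolding gcol[symmetric] by (rule image_comp[symmetric])
  also have "\<dots> = insert 0 ({..<n} - first_row)"
    using permutes_not_in[OF p] by (auto simp: p_def)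
  finally have "(p \<circ> g) ` first_col = first_col" by (simp add: col_eq)
  moreover have "p \<circ> g permutes {..<n}"
    using permutes_compose[OF g permutes_subset[OF p first_row_subset]] .
  ultimately obtain h1 h2 where h: "h1 permutes first_col" "h2 permutes {..<n} - first_col" "p \<circ> g = h2 \<circ> h1"
    using permutes_split[of "p \<circ> g" "{..<n}" first_col] first_col_subset by metis
  have "h2 permutes first_row"
    by (rule permutes_subset[OF h(2)]) (auto simp: in_row_iff)
  then have "p \<circ> h2 permutes first_row" using p permutes_compose by blast
  moreover have "g = (p \<circ> h2) \<circ> h1"
  proof -
    have "g = (p \<circ> p) \<circ> g" by (simp add: pp)
    also have "\<dots> = p \<circ> (p \<circ> g)" by (simp only: o_assoc)
    finally show ?thesis by (simp add: h(3) o_assoc)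
  qed
  ultimately show ?thesis using h(1) by metis
qed

text \<open>
  Both symmetries determine \<open>X\<close> on products \<open>p q\<close> from its value at the identity. On the other
  permutations \<open>X g = X (t g) = X (g s) = - X g\<close>, where \<open>t g = g s\<close> as in the dichotomy above.
\<close>

lemma bi_invariant_multiple:
  fixes X :: "(nat \<Rightarrow> nat) \<Rightarrow> 'k::field_char_0"
  assumes left: "\<And>p g. p permutes first_row \<Longrightarrow> X (p \<circ> g) = X g"
    and right: "\<And>q g. q permutes first_col \<Longrightarrow> X (g \<circ> q) = of_int (sign q) * X g"
    and supp: "\<And>g. \<not> g permutes {..<n} \<Longrightarrow> X g = 0"
  shows "X = fun_scale (X id) symmetrizer"
proof
  fix g
  show "X g = fun_scale (X id) symmetrizer g"
  proof (cases "g permutes {..<n}")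
    case True
    from double_coset[OF this] show ?thesis
    proof (elim disjE exE conjE)
      fix p q assume pq: "p permutes first_row" "q permutes first_col" "g = p \<circ> q"
      have val: "Y g = of_int (sign q) * Y id"
        if "\<And>p g. p permutes first_row \<Longrightarrow> Y (p \<circ> g) = Y g"
          "\<And>q g. q permutes first_col \<Longrightarrow> Y (g \<circ> q) = of_int (sign q) * Y g" for Y :: "(nat \<Rightarrow> nat) \<Rightarrow> 'k"
        using that(1)[OF pq(1), of q] that(2)[OF pq(2), of id] pq(3) by simp
      show ?thesis
        using val[of X, OF left right] val[of symmetrizer, OF symmetrizer_row_left symmetrizer_col_right]
        by (simp add: fun_scale_def symmetrizer_id)
    next
      fix t s assume ts: "t permutes first_row" "s permutes first_col" "sign s = - 1" "t \<circ> g = g \<circ> s"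
      have val: "Y g = 0"
        if "\<And>p g. p permutes first_row \<Longrightarrow> Y (p \<circ> g) = Y g"
          "\<And>q g. q permutes first_col \<Longrightarrow> Y (g \<circ> q) = of_int (sign q) * Y g" for Y :: "(nat \<Rightarrow> nat) \<Rightarrow> 'k"
      proof -
        have "Y g = - Y g" using that(1)[OF ts(1), of g] that(2)[OF ts(2), of g] ts(3,4) by simp
        then show ?thesis by simp
      qed
      show ?thesis
        using val[of X, OF left right] val[of symmetrizer, OF symmetrizer_row_left symmetrizer_col_right]
        by (simp add: fun_scale_def)
    qed
  qed (simp add: supp symmetrizer_support fun_scale_def)
qed

text \<open>
  The product \<open>c \<sigma> c\<close> has the symmetries of \<open>c\<close> on the left and on the right.
\<close>

lemma primitive_element_symmetrizer: "primitive_element n (symmetrizer :: _ \<Rightarrow> 'k::field_char_0)"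
proof
  let ?c = "symmetrizer :: _ \<Rightarrow> 'k"
  show "?c \<noteq> 0" using symmetrizer_id by (metis zero_fun_apply zero_neq_one)
  interpret reg: symmetric_action n "left_mult :: _ \<Rightarrow> ((nat \<Rightarrow> nat) \<Rightarrow> 'k) \<Rightarrow> _"
    by (rule symmetric_action_left_mult)
  fix \<sigma> :: "nat \<Rightarrow> nat" assume \<sigma>: "\<sigma> permutes {..<n}"
  define X where "X = algebra_act n left_mult ?c (left_mult \<sigma> ?c)"
  have X: "X g = (\<Sum>h | h permutes {..<n}. ?c h * ?c (inv_into UNIV \<sigma> \<circ> (inv_into UNIV h \<circ> g)))" for g
    by (simp add: X_def algebra_act_def sum_fun_apply fun_scale_def left_mult_def)
  have "X = fun_scale (X id) ?c"
  proof (rule bi_invariant_multiple)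
    fix p g assume p: "p permutes first_row"
    let ?p = "inv_into UNIV p"
    have p': "?p permutes {..<n}" using p first_row_subset by (meson permutes_inv permutes_subset)
    have "left_mult ?p ?c = ?c"
      unfolding left_mult_def permutes_inv_inv[OF p] by (rule ext) (rule symmetrizer_row_left[OF p])
    then have "X = left_mult ?p X"
      unfolding X_def using reg.algebra_act_left_mult[OF p'] by metis
    then show "X (p \<circ> g) = X g"
      by (metis left_mult_def permutes_inv_inv[OF p])
  next
    fix q g assume q: "q permutes first_col"
    show "X (g \<circ> q) = of_int (sign q) * X g"
      unfolding X sum_distrib_left o_assoc symmetrizer_col_right[OF q]
      by (intro sum.cong refl) (simp add: algebra_simps)
  next
    fix g assume g: "\<not> g permutes {..<n}"
    have "\<not> inv_into UNIV \<sigma> \<circ> (inv_into UNIV h \<circ> g) permutes {..<n}" if h: "h permutes {..<n}" for h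
    proof
      assume "inv_into UNIV \<sigma> \<circ> (inv_into UNIV h \<circ> g) permutes {..<n}"
      then have "h \<circ> (\<sigma> \<circ> (inv_into UNIV \<sigma> \<circ> (inv_into UNIV h \<circ> g))) permutes {..<n}"
        using h \<sigma> permutes_compose by blast
      moreover have "h \<circ> (\<sigma> \<circ> (inv_into UNIV \<sigma> \<circ> (inv_into UNIV h \<circ> g))) = g"
        using permutes_inverses[OF h] permutes_inverses[OF \<sigma>] by (simp add: fun_eq_iff)
      ultimately show False using g by simp
    qed
    then show "X g = 0" by (simp add: X symmetrizer_support)
  qed
  then show "\<exists>a. algebra_act n left_mult ?c (left_mult \<sigma> ?c) = fun_scale a ?c"
    unfolding X_def by (intro exI)
qed (rule symmetrizer_support)

lemma algebra_act_symmetrizer: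
  "algebra_act n permute_factors symmetrizer T = symmetrize first_row (alternate first_col T)"
proof
  fix w
  let ?G = "{g. g permutes {..<n}}" and ?R = "{p. p permutes first_row}" and ?C = "{q. q permutes first_col}"
  have "algebra_act n permute_factors symmetrizer T w = (\<Sum>g\<in>?G. symmetrizer g * T (w \<circ> g))"
    by (simp add: algebra_act_def sum_fun_apply fun_scale_def permute_factors_def)
  also have "\<dots> = (\<Sum>g\<in>?G. \<Sum>p\<in>?R. \<Sum>q\<in>?C. if p \<circ> q = g then of_int (sign q) * T (w \<circ> (p \<circ> q)) else 0)"
    by (rule sum.cong[OF refl], subst symmetrizer_eq)
      (auto simp: sum_distrib_right intro!: sum.cong)
  also have "\<dots> = (\<Sum>p\<in>?R. \<Sum>q\<in>?C. \<Sum>g\<in>?G. if p \<circ> q = g then of_int (sign q) * T (w \<circ> (p \<circ> q)) else 0)"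
    by (subst sum.swap, rule sum.cong[OF refl], rule sum.swap)
  also have "\<dots> = (\<Sum>p\<in>?R. \<Sum>q\<in>?C. of_int (sign q) * T (w \<circ> (p \<circ> q)))"
  proof (intro sum.cong refl)
    fix p q assume "p \<in> ?R" "q \<in> ?C"
    then have "p \<circ> q permutes {..<n}"
      using permutes_subset[OF _ first_row_subset] permutes_subset[OF _ first_col_subset]
      by (simp add: permutes_compose)
    then show "(\<Sum>g\<in>?G. if p \<circ> q = g then of_int (sign q) * T (w \<circ> (p \<circ> q)) else 0) =
        of_int (sign q) * T (w \<circ> (p \<circ> q))"
      by (simp add: finite_permutations)
  qed
  finally show "algebra_act n permute_factors symmetrizer T w = symmetrize first_row (alternate first_col T) w"
    by (simp add: symmetrize_def alternate_def o_assoc)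
qed

end


section \<open>Straightening\<close>

definition tensor :: "nat \<Rightarrow> nat \<Rightarrow> (nat \<Rightarrow> nat \<Rightarrow> 'k::field) \<Rightarrow> (nat \<Rightarrow> nat) \<Rightarrow> 'k" where
  "tensor r n u = (\<lambda>w. if w \<in> tensor_words r n then \<Prod>i<n. u i (w i) else 0)"

lemma tensor_words_comp:
  assumes "\<sigma> permutes {..<n}"
  shows "w \<circ> \<sigma> \<in> tensor_words r n \<longleftrightarrow> w \<in> tensor_words r n"
proof -
  have *: "w \<circ> \<sigma> \<in> tensor_words r n" if "w \<in> tensor_words r n" "\<sigma> permutes {..<n}" for w \<sigma>
    using that permutes_in_image[OF that(2)] permutes_not_in[OF that(2)]
    by (auto simp: tensor_words_def PiE_iff extensional_def)
  have "w = (w \<circ> \<sigma>) \<circ> inv_into UNIV \<sigma>"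
    using permutes_inv_o[OF assms] by (simp add: o_assoc[symmetric])
  then show ?thesis
    using *[OF _ assms] *[OF _ permutes_inv[OF assms]] by metis
qed

lemma permute_factors_tensor:
  assumes \<sigma>: "\<sigma> permutes {..<n}"
  shows "permute_factors \<sigma> (tensor r n u) = tensor r n (\<lambda>i. u (inv_into UNIV \<sigma> i))"
proof
  fix w
  have "(\<Prod>i<n. u (inv_into UNIV \<sigma> i) (w i)) = (\<Prod>i<n. u i (w (\<sigma> i)))"
    using prod.permute[OF \<sigma>, of "\<lambda>i. u (inv_into UNIV \<sigma> i) (w i)"]
    by (simp add: o_def permutes_inverses[OF \<sigma>])
  then show "permute_factors \<sigma> (tensor r n u) w = tensor r n (\<lambda>i. u (inv_into UNIV \<sigma> i)) w"
    by (simp add: permute_factors_def tensor_def tensor_words_comp[OF \<sigma>])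
qed

lemma column_tensor_eq:
  "column_tensor v = tensor (dim_row v) (dim_col v) (\<lambda>j a. v $$ (a, j))"
  by (simp add: column_tensor_def tensor_def)

lemma permute_factors_comp: "permute_factors (\<sigma> \<circ> \<tau>) T = permute_factors \<sigma> (permute_factors \<tau> T)"
  by (simp add: permute_factors_def o_assoc)

lemma alternate_eq_sum:
  "alternate S T = (\<Sum>q | q permutes S. fun_scale (of_int (sign q)) (permute_factors q T))"
  by (rule ext) (simp add: alternate_def sum_fun_apply fun_scale_def permute_factors_def)

lemma alternate_add: "alternate S (T + T') = alternate S T + alternate S T'"
  by (rule ext) (simp add: alternate_def sum.distrib algebra_simps)

lemma alternate_scale: "alternate S (fun_scale a T) = fun_scale a (alternate S T)"
  by (rule ext) (simp add: alternate_def fun_scale_def sum_distrib_left algebra_simps)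

lemma alternate_zero: "alternate S 0 = 0"
  by (rule ext) (simp add: alternate_def)

lemma alternate_sum: "alternate S (\<Sum>i\<in>I. f i) = (\<Sum>i\<in>I. alternate S (f i))"
  using sum_comp_morphism[of "alternate S" f I, OF alternate_zero alternate_add]
  unfolding o_def by (rule sym)

lemma symmetrize_add: "symmetrize S (T + T') = symmetrize S T + symmetrize S T'"
  by (rule ext) (simp add: symmetrize_def sum.distrib)

lemma symmetrize_scale: "symmetrize S (fun_scale a T) = fun_scale a (symmetrize S T)"
  by (rule ext) (simp add: symmetrize_def fun_scale_def sum_distrib_left)

lemma symmetrize_permute:
  assumes "p permutes S"
  shows "symmetrize S (permute_factors p T) = symmetrize S T"
proof
  fix w
  show "symmetrize S (permute_factors p T) w = symmetrize S T w"
    unfolding symmetrize_def permute_factors_def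
    by (subst (2) sum_permutations_compose_right[OF assms]) (simp add: o_assoc)
qed

lemma sign_comp_permutes:
  assumes "finite S" "p permutes S" "q permutes S"
  shows "sign (p \<circ> q) = sign p * sign q"
  using assms permutes_imp_permutation by (intro sign_compose) blast+

lemma alternate_permute:
  fixes T :: "(nat \<Rightarrow> nat) \<Rightarrow> 'k::field"
  assumes S: "finite S" and q: "q permutes S"
  shows "alternate S (permute_factors q T) = fun_scale (of_int (sign q)) (alternate S T)"
proof
  fix w
  have "alternate S T w = (\<Sum>q' | q' permutes S. of_int (sign (q' \<circ> q)) * T (w \<circ> (q' \<circ> q)))"
    unfolding alternate_def by (rule sum_permutations_compose_right[OF q])
  also have "\<dots> = (\<Sum>q' | q' permutes S. of_int (sign q) * (of_int (sign q') * T (w \<circ> q' \<circ> q)))"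
    by (rule sum.cong) (auto simp: sign_comp_permutes[OF S _ q] o_assoc)
  finally have "alternate S T w = of_int (sign q) * alternate S (permute_factors q T) w"
    by (simp add: alternate_def permute_factors_def sum_distrib_left)
  moreover have "of_int (sign q) * of_int (sign q) = (1 :: 'k)"
    by (metis of_int_1 of_int_mult sign_idempotent)
  ultimately show "alternate S (permute_factors q T) w = fun_scale (of_int (sign q)) (alternate S T) w"
    by (simp add: fun_scale_def mult.assoc[symmetric])
qed

lemma permute_alternate:
  fixes T :: "(nat \<Rightarrow> nat) \<Rightarrow> 'k::field"
  assumes S: "finite S" and q: "q permutes S"
  shows "permute_factors q (alternate S T) = fun_scale (of_int (sign q)) (alternate S T)"
proof
  fix w
  have "alternate S T w = (\<Sum>q' | q' permutes S. of_int (sign (q \<circ> q')) * T (w \<circ> (q \<circ> q')))"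
    unfolding alternate_def by (rule setum_permutations_compose_left[OF q])
  also have "\<dots> = (\<Sum>q' | q' permutes S. of_int (sign q) * (of_int (sign q') * T (w \<circ> q \<circ> q')))"
    by (rule sum.cong) (auto simp: sign_comp_permutes[OF S q] o_assoc)
  finally have "alternate S T w = of_int (sign q) * permute_factors q (alternate S T) w"
    by (simp add: alternate_def permute_factors_def sum_distrib_left)
  moreover have "of_int (sign q) * of_int (sign q) = (1 :: 'k)"
    by (metis of_int_1 of_int_mult sign_idempotent)
  ultimately show "permute_factors q (alternate S T) w = fun_scale (of_int (sign q)) (alternate S T) w"
    by (simp add: fun_scale_def mult.assoc[symmetric])
qed

lemma alternate_alternate_subset:
  fixes T :: "(nat \<Rightarrow> nat) \<Rightarrow> 'k::field"
  assumes S: "S \<subseteq> B" and B: "finite B"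
  shows "alternate B (alternate S T) = fun_scale (of_nat (card {q. q permutes S})) (alternate B T)"
proof -
  have "alternate B (alternate S T) =
      (\<Sum>q | q permutes S. fun_scale (of_int (sign q)) (fun_scale (of_int (sign q)) (alternate B T)))"
    unfolding alternate_eq_sum[of S] alternate_sum alternate_scale
    by (rule sum.cong) (auto simp: alternate_permute[OF B permutes_subset[OF _ S]])
  also have "\<dots> = (\<Sum>q | q permutes S. alternate B T)"
    by (rule sum.cong[OF refl]) (metis funspace.scale_one funspace.scale_scale of_int_1 of_int_mult sign_idempotent)
  finally show ?thesis
    by (auto simp: fun_scale_def sum_fun_apply fun_eq_iff)
qed

text \<open>
  The antisymmetrizer of \<open>S \<union> {a}\<close> factors through that of \<open>S\<close>: the transpositions \<open>(a d)\<close>,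
  together with the identity, represent the cosets.
\<close>

lemma alternate_insert:
  fixes T :: "(nat \<Rightarrow> nat) \<Rightarrow> 'k::field"
  assumes S: "finite S" "a \<notin> S"
  shows "alternate (insert a S) T = alternate S (T - (\<Sum>d\<in>S. permute_factors (transpose a d) T))"
proof -
  have "alternate (insert a S) T w =
      (\<Sum>b\<in>insert a S. of_int (sign (transpose a b)) * alternate S (permute_factors (transpose a b) T) w)" for w
  proof -
    let ?f = "\<lambda>p. of_int (sign p) * T (w \<circ> p)"
    have "alternate (insert a S) T w = (\<Sum>p | p permutes insert a S. ?f (inv_into UNIV p))"
      unfolding alternate_def by (rule sum_permutations_inverse)
    also have "\<dots> = (\<Sum>b\<in>insert a S. \<Sum>q | q permutes S. ?f (inv_into UNIV (transpose a b \<circ> q)))"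
      by (rule sum_over_permutations_insert[OF S])
    also have "\<dots> = (\<Sum>b\<in>insert a S. \<Sum>q | q permutes S.
        of_int (sign (transpose a b)) * (of_int (sign (inv_into UNIV q)) * T (w \<circ> inv_into UNIV q \<circ> transpose a b)))"
    proof (intro sum.cong refl)
      fix b q assume "b \<in> insert a S" "q \<in> {q. q permutes S}"
      then have q: "q permutes S" by simp
      have "inv_into UNIV (transpose a b \<circ> q) = inv_into UNIV q \<circ> transpose a b"
        using permutes_bij[OF q] by (simp add: o_inv_distrib)
      moreover have "sign (inv_into UNIV q \<circ> transpose a b) = sign (inv_into UNIV q) * sign (transpose a b)"
        using permutes_inv[OF q] S(1)
        by (intro sign_compose permutation_swap_id) (auto intro: permutes_imp_permutation)
      ultimately show "?f (inv_into UNIV (transpose a b \<circ> q)) = of_int (sign (transpose a b)) *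
          (of_int (sign (inv_into UNIV q)) * T (w \<circ> inv_into UNIV q \<circ> transpose a b))"
        by (simp add: o_assoc)
    qed
    also have "\<dots> = (\<Sum>b\<in>insert a S. of_int (sign (transpose a b)) *
        (\<Sum>q | q permutes S. of_int (sign (inv_into UNIV q)) * T (w \<circ> inv_into UNIV q \<circ> transpose a b)))"
      by (simp add: sum_distrib_left)
    also have "\<dots> = (\<Sum>b\<in>insert a S. of_int (sign (transpose a b)) * alternate S (permute_factors (transpose a b) T) w)"
      unfolding alternate_def permute_factors_def
      by (subst sum_permutations_inverse[symmetric]) simp
    finally show ?thesis .
  qed
  moreover have "(\<Sum>b\<in>insert a S. of_int (sign (transpose a b)) * alternate S (permute_factors (transpose a b) T) w) =
      alternate S (T - (\<Sum>d\<in>S. permute_factors (transpose a d) T)) w" for w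
  proof -
    have "(\<Sum>d\<in>S. of_int (sign (transpose a d)) * alternate S (permute_factors (transpose a d) T) w) =
        (\<Sum>d\<in>S. - alternate S (permute_factors (transpose a d) T) w)"
      using S(2) by (intro sum.cong refl) (auto simp: sign_swap_id)
    moreover have "alternate S (T - X) = alternate S T - alternate S X" for X
      by (rule ext) (simp add: alternate_def sum_subtractf algebra_simps)
    ultimately show ?thesis
      using S by (simp add: alternate_sum sum_fun_apply sum_negf permute_factors_def)
  qed
  ultimately show ?thesis by (intro ext) simp
qed

lemma alternate_symmetric_zero:
  fixes T :: "(nat \<Rightarrow> nat) \<Rightarrow> 'k::field_char_0"
  assumes "finite S" "a \<in> S" "b \<in> S" "a \<noteq> b" "permute_factors (transpose a b) T = T"
  shows "alternate S T = 0"
proof -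
  have "alternate S T = fun_scale (- 1) (alternate S T)"
    using alternate_permute[OF assms(1) permutes_swap_id[OF assms(2,3)], of T] assms(4,5)
    by (simp add: sign_swap_id)
  then have "alternate S T w = - alternate S T w" for w
    by (metis fun_scale_def mult_minus1)
  then show ?thesis by (intro ext) simp
qed

text \<open>
  The factor at position \<open>i0\<close> is a combination of the other factors in \<open>S\<close>. By multilinearity the
  tensor is a combination of tensors with a repeated factor, and antisymmetrization kills those.
\<close>

lemma alternate_tensor_dependent:
  fixes u :: "nat \<Rightarrow> nat \<Rightarrow> 'k::field_char_0"
  assumes S: "S \<subseteq> {..<n}" and dep: "\<And>a. a < r \<Longrightarrow> (\<Sum>i\<in>S. \<gamma> i * u i a) = 0"
    and i0: "i0 \<in> S" "\<gamma> i0 \<noteq> 0"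
  shows "alternate S (tensor r n u) = 0"
proof -
  have fin: "finite S" using S by (rule finite_subset) simp
  have i0n: "i0 < n" using i0 S by auto
  let ?u = "\<lambda>i. u(i0 := u i)"
  have split: "tensor r n (u(i0 := x)) w =
      (if w \<in> tensor_words r n then x (w i0) * (\<Prod>i\<in>{..<n} - {i0}. u i (w i)) else 0)" for x w
    using i0n by (simp add: tensor_def prod.remove[of "{..<n}" i0])
  have expand: "fun_scale (\<gamma> i0) (tensor r n u) = (\<Sum>i\<in>S - {i0}. fun_scale (- \<gamma> i) (tensor r n (?u i)))"
  proof
    fix w
    show "fun_scale (\<gamma> i0) (tensor r n u) w = (\<Sum>i\<in>S - {i0}. fun_scale (- \<gamma> i) (tensor r n (?u i))) w"
    proof (cases "w \<in> tensor_words r n")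
      case True
      then have "w i0 < r" using i0n by (auto simp: tensor_words_def)
      from dep[OF this] have "\<gamma> i0 * u i0 (w i0) = (\<Sum>i\<in>S - {i0}. - \<gamma> i * u i (w i0))"
        using fin i0(1) by (simp add: sum.remove[of S i0] sum_negf eq_neg_iff_add_eq_0)
      then have "\<gamma> i0 * u i0 (w i0) * (\<Prod>i\<in>{..<n} - {i0}. u i (w i)) =
          (\<Sum>i\<in>S - {i0}. - \<gamma> i * u i (w i0) * (\<Prod>i\<in>{..<n} - {i0}. u i (w i)))"
        by (simp add: sum_distrib_right)
      then show ?thesis
        using True split[of "u i0" w] by (simp add: sum_fun_apply fun_scale_def split mult.assoc)
    next
      case False
      then show ?thesis by (simp add: sum_fun_apply fun_scale_def tensor_def)
    qed
  qed
  have "alternate S (tensor r n (?u i)) = 0" if i: "i \<in> S - {i0}" for i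
  proof (rule alternate_symmetric_zero[OF fin i0(1), of i])
    have "transpose i0 i permutes {..<n}" using i i0n S by (intro permutes_swap_id) auto
    then show "permute_factors (transpose i0 i) (tensor r n (?u i)) = tensor r n (?u i)"
      using i by (subst permute_factors_tensor) (auto simp: transpose_def intro!: arg_cong[of _ _ "tensor r n"])
  qed (use i in auto)
  then have "(\<Sum>i\<in>S - {i0}. fun_scale (- \<gamma> i) (alternate S (tensor r n (?u i)))) = 0"
    by (intro sum.neutral ballI) (simp del: funspace.scale_minus_left)
  moreover have "fun_scale (\<gamma> i0) (alternate S (tensor r n u)) =
      (\<Sum>i\<in>S - {i0}. fun_scale (- \<gamma> i) (alternate S (tensor r n (?u i))))"
    unfolding alternate_scale[symmetric] expand alternate_sum ..
  ultimately have "fun_scale (\<gamma> i0) (alternate S (tensor r n u)) = 0" by simp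
  then show ?thesis using i0(2) by simp
qed

lemma alternate_dependent_columns:
  fixes v :: "'k::field_char_0 mat"
  assumes g: "g permutes {..<dim_col v}" and J: "J \<subseteq> {..<dim_col v}"
    and dep: "J \<notin> indep (column_matroid v)"
  shows "alternate (g ` J) (permute_factors g (column_tensor v)) = 0"
proof -
  obtain c j0 where c: "\<And>a. a < dim_row v \<Longrightarrow> (\<Sum>j\<in>J. c j * v $$ (a, j)) = 0"
    and j0: "j0 \<in> J" "c j0 \<noteq> (0 :: 'k)"
    using dep J by (auto simp: column_matroid_def)
  let ?g = "inv_into UNIV g"
  have inj: "inj_on g J" using permutes_inj[OF g] by (auto intro: inj_on_subset)
  show ?thesis
    unfolding column_tensor_eq permute_factors_tensor[OF g]
  proof (rule alternate_tensor_dependent[where \<gamma> = "\<lambda>i. c (?g i)" and ?i0.0 = "g j0"])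
    show "g ` J \<subseteq> {..<dim_col v}" using J permutes_image[OF g] by blast
    show "(\<Sum>i\<in>g ` J. c (?g i) * v $$ (a, ?g i)) = 0" if "a < dim_row v" for a
      using c[OF that] by (simp add: sum.reindex[OF inj] permutes_inverses[OF g])
  qed (use j0 in \<open>auto simp: permutes_inverses[OF g]\<close>)
qed

lemma column_matroid_subset:
  assumes I: "I \<in> indep (column_matroid v)" and J: "J \<subseteq> I"
  shows "J \<in> indep (column_matroid v)"
proof -
  have In: "I \<subseteq> {..<dim_col v}" using I by (simp add: column_matroid_def)
  then have fin: "finite I" by (rule finite_subset) simp
  have "c j = 0" if c: "\<forall>a<dim_row v. (\<Sum>j\<in>J. c j * v $$ (a, j)) = 0" and j: "j \<in> J" for c j
  proof -
    let ?c = "\<lambda>j. if j \<in> J then c j else 0"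
    have "(\<Sum>j\<in>I. ?c j * v $$ (a, j)) = (\<Sum>j\<in>J. c j * v $$ (a, j))" for a
      by (rule sum.mono_neutral_cong_right) (use fin J in auto)
    then have zero: "\<forall>a<dim_row v. (\<Sum>j\<in>I. ?c j * v $$ (a, j)) = 0" using c by simp
    have "(\<forall>a<dim_row v. (\<Sum>j\<in>I. c j * v $$ (a, j)) = 0) \<longrightarrow> (\<forall>j\<in>I. c j = 0)" for c
      using I by (simp add: column_matroid_def)
    from mp[OF this[of ?c] zero] have "\<forall>j\<in>I. ?c j = 0" .
    from bspec[OF this subsetD[OF J j]] show ?thesis using j by simp
  qed
  then show ?thesis using In J by (auto simp: column_matroid_def)
qed

context hook_shape
begin

text \<open>
  This is the action of the Young symmetrizer, see \<open>algebra_act_symmetrizer\<close>.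
\<close>

definition project :: "((nat \<Rightarrow> nat) \<Rightarrow> 'k::field_char_0) \<Rightarrow> (nat \<Rightarrow> nat) \<Rightarrow> 'k" where
  "project T = symmetrize first_row (alternate first_col T)"

lemma project_add: "project (T + T') = project T + project T'"
  by (simp add: project_def alternate_add symmetrize_add)

lemma project_scale: "project (fun_scale a T) = fun_scale a (project T)"
  by (simp add: project_def alternate_scale symmetrize_scale)

lemma project_zero: "project 0 = 0"
  using project_scale[of 0 0] by simp

lemma project_sum: "project (\<Sum>i\<in>I. f i) = (\<Sum>i\<in>I. project (f i))"
  using sum_comp_morphism[of project f I, OF project_zero project_add]
  unfolding o_def by (rule sym)

lemma project_diff: "project (T - T') = project T - project T'"
  using project_add[of "T - T'" T'] by (simp add: algebra_simps)

lemma project_col: "q permutes first_col \<Longrightarrow> project (permute_factors q T) = fun_scale (of_int (sign q)) (project T)"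
  by (simp add: project_def alternate_permute symmetrize_scale)

lemma project_complement:
  assumes h: "h permutes {..<n} - first_col"
  shows "project (permute_factors h T) = project T"
proof -
  have comm: "q \<circ> h = h \<circ> q" if q: "q permutes first_col" for q
  proof
    fix x
    show "(q \<circ> h) x = (h \<circ> q) x"
      using permutes_not_in[OF h, of x] permutes_not_in[OF q, of x] permutes_in_image[OF h, of x]
        permutes_in_image[OF q, of x] permutes_not_in[OF h, of "q x"] permutes_not_in[OF q, of "h x"]
      by (cases "x \<in> first_col") auto
  qed
  have "alternate first_col (permute_factors h T) = permute_factors h (alternate first_col T)"
  proof
    fix w
    show "alternate first_col (permute_factors h T) w = permute_factors h (alternate first_col T) w"
      unfolding alternate_def permute_factors_def
      by (rule sum.cong) (auto simp: o_assoc[symmetric] comm)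
  qed
  moreover have "h permutes first_row"
    by (rule permutes_subset[OF h]) (auto simp: in_row_iff)
  ultimately show ?thesis by (simp add: project_def symmetrize_permute)
qed

text \<open>
  The permutation \<open>g' g\<inverse>\<close> preserves the first column; it splits into a permutation of the column,
  which contributes its sign, and a permutation of the rest of the row, which contributes nothing.
\<close>

lemma project_same_columns:
  assumes g: "g permutes {..<n}" and g': "g' permutes {..<n}"
    and same: "g -` first_col = g' -` first_col"
  obtains s where "project (permute_factors g' T) = fun_scale s (project (permute_factors g T))"
proof -
  define h where "h = g' \<circ> inv_into UNIV g"
  have h: "h permutes {..<n}"
    unfolding h_def using g g' by (simp add: permutes_compose permutes_inv)
  have g'_eq: "g' = h \<circ> g"
    unfolding h_def using permutes_inv_o[OF g] by (simp add: o_assoc[symmetric])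
  have "h ` first_col = first_col"
  proof (rule card_subset_eq)
    show "h ` first_col \<subseteq> first_col"
    proof
      fix y assume "y \<in> h ` first_col"
      then obtain x where x: "x \<in> first_col" "y = g' (inv_into UNIV g x)" by (auto simp: h_def)
      then have "inv_into UNIV g x \<in> g -` first_col" using permutes_inverses[OF g] by simp
      then show "y \<in> first_col" unfolding same x(2) by simp
    qed
    have "inj_on h first_col" using permutes_inj[OF h] by (rule inj_on_subset) simp
    then show "card (h ` first_col) = card first_col" by (rule card_image)
  qed simp
  then obtain h1 h2 where "h1 permutes first_col" "h2 permutes {..<n} - first_col" "h = h2 \<circ> h1"
    using permutes_split[OF h first_col_subset] by metis
  then have "project (permute_factors g' T) = fun_scale (of_int (sign h1)) (project (permute_factors g T))"
    unfolding g'_eq by (simp add: permute_factors_comp project_complement project_col)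
  then show ?thesis by (rule that)
qed

text \<open>
  The left side minus the right side is, up to sign, an antisymmetrization over the column and one
  more entry \<open>a\<close> of the row, followed by symmetrization over the row; the transposition \<open>(0 a)\<close> changes
  the sign of the former and is absorbed by the latter. This is the identity \<open>\<partial>\<partial> = 0\<close> of the
  Orlik-Solomon differential.
\<close>

lemma project_exchange_all:
  assumes a: "a < n" "a \<notin> first_col"
  shows "project (\<Sum>d\<in>first_col. permute_factors (transpose a d) T) = project T"
proof -
  let ?X = "alternate (insert a first_col) T"
  have "a \<in> first_row" using a in_row_iff by blast
  then have "symmetrize first_row ?X = symmetrize first_row (permute_factors (transpose 0 a) ?X)"
    using zero_in_first_row by (simp add: symmetrize_permute permutes_swap_id)
  also have "permute_factors (transpose 0 a) ?X = fun_scale (-1) ?X"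
  proof -
    have "transpose 0 a permutes insert a first_col" "0 \<noteq> a"
      using zero_in_first_col a(2) by (simp add: permutes_swap_id, metis)
    then show ?thesis by (simp add: permute_alternate sign_swap_id)
  qed
  finally have "symmetrize first_row ?X = fun_scale (-1) (symmetrize first_row ?X)"
    unfolding symmetrize_scale .
  then have "symmetrize first_row ?X w = - symmetrize first_row ?X w" for w
    by (metis fun_scale_def mult_minus1)
  then have "symmetrize first_row ?X = 0" by (intro ext) simp
  then have "project (T - (\<Sum>d\<in>first_col. permute_factors (transpose a d) T)) = 0"
    using alternate_insert[of first_col a T] a(2) by (simp add: project_def)
  then show ?thesis by (simp add: project_diff)
qed

text \<open>
  The analogue of the Orlik-Solomon relation \<open>\<partial>e\<^sub>C = 0\<close> for a dependent set \<open>C\<close>: in the application,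
  \<open>insert a D\<close> carries dependent columns, which makes the hypothesis true.
\<close>

lemma project_exchange_dependent:
  assumes D: "D \<subseteq> first_col" "a \<notin> D" and zero: "alternate (insert a D) T = 0"
  shows "project (\<Sum>d\<in>D. permute_factors (transpose a d) T) = project T"
proof -
  let ?Y = "T - (\<Sum>d\<in>D. permute_factors (transpose a d) T)"
  have fin: "finite D" using D(1) by (rule finite_subset) simp
  have "alternate D ?Y = 0" using alternate_insert[OF fin D(2), of T] zero by simp
  then have "fun_scale (of_nat (card {q. q permutes D})) (alternate first_col ?Y) = 0"
    using alternate_alternate_subset[OF D(1) finite_first_col, of ?Y] by (simp add: alternate_zero)
  moreover have "card {q. q permutes D} \<noteq> 0" using card_permutations[OF refl fin] by simp
  ultimately have "alternate first_col ?Y = 0" by simp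
  then have "project ?Y = 0" using project_zero by (simp add: project_def alternate_zero)
  then show ?thesis by (simp add: project_diff)
qed

end

text \<open>
  The condition on \<open>I\<close> is the nbc condition without circuits: no element \<open>m\<close> of the ground set
  depends on the elements of \<open>I\<close> above it. For \<open>m \<in> I\<close> this includes the independence of \<open>I\<close> itself.
  The requirement \<open>0 \<in> I\<close> expresses the circuits of size \<open>k + 1\<close> that truncation to rank \<open>k\<close> adds.
\<close>

definition nbc_family :: "'k::field mat \<Rightarrow> nat \<Rightarrow> nat set set" where
  "nbc_family v k = {I. I \<subseteq> {..<dim_col v} \<and> card I = k \<and> 0 \<in> I \<and>
     (\<forall>m<dim_col v. insert m {i \<in> I. m < i} \<in> indep (column_matroid v))}"

text \<open>
  Every exchange lowers the sum of the elements of \<open>I\<close>. If \<open>I\<close> is dependent, its tensor is zero. If \<open>m \<notin> I\<close> and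
  \<open>m\<close> depends on the set \<open>D\<close> of larger elements of \<open>I\<close>, the exchange relation for \<open>D\<close> expresses the
  tensor of \<open>I\<close> by those of \<open>I\<close> with some \<open>j \<in> D\<close> replaced by \<open>m\<close>. If \<open>0 \<notin> I\<close>, the same
  works with \<open>m = 0\<close> and \<open>D = I\<close>, without any dependence.
\<close>

lemma (in hook_shape) straightening:
  fixes v :: "'k::field_char_0 mat"
  assumes n: "dim_col v = n" and g: "g permutes {..<n}"
  shows "project (permute_factors g (column_tensor v)) \<in> funspace.span
    {project (permute_factors g' (column_tensor v)) | g'. g' permutes {..<n} \<and> g' -` first_col \<in> nbc_family v k}"
    (is "?P g \<in> funspace.span ?G")
  using g
proof (induction "\<Sum>(g -` first_col)" arbitrary: g rule: less_induct)
  case (less g)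
  note g = less.prems
  let ?I = "g -` first_col" and ?t = "permute_factors g (column_tensor v)"
  have inj: "inj g" using g by (rule permutes_inj)
  have gI: "g ` ?I = first_col" using permutes_surj[OF g] by (simp add: surj_image_vimage_eq)
  have I: "?I \<subseteq> {..<n}"
  proof
    fix j assume "j \<in> ?I"
    then have "g j \<in> {..<n}" using first_col_subset by auto
    then show "j \<in> {..<n}" using permutes_in_image[OF g] by blast
  qed
  then have finI: "finite ?I" by (rule finite_subset) simp
  have cardI: "card ?I = k"
    using card_image[of g ?I] gI card_first_col inj by (simp add: inj_on_subset)
  have exchange: "?P g \<in> funspace.span ?G"
    if m: "m < n" "m \<notin> ?I" and D: "D \<subseteq> ?I" "\<And>j. j \<in> D \<Longrightarrow> m < j"
      and eq: "project (\<Sum>d\<in>g ` D. permute_factors (transpose (g m) d) ?t) = ?P g" for m D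
  proof -
    have sum_eq: "(\<Sum>d\<in>g ` D. permute_factors (transpose (g m) d) ?t) =
        (\<Sum>j\<in>D. permute_factors (g \<circ> transpose m j) (column_tensor v))"
    proof -
      have "transpose (g m) (g j) \<circ> g = g \<circ> transpose m j" for j
        using inj by (auto simp: fun_eq_iff transpose_def inj_eq)
      moreover have "inj_on g D" using inj by (rule inj_on_subset) simp
      ultimately show ?thesis
        by (subst sum.reindex) (auto simp: permute_factors_comp[symmetric])
    qed
    have "?P g = (\<Sum>j\<in>D. ?P (g \<circ> transpose m j))"
      using eq[symmetric] unfolding sum_eq project_sum .
    moreover have "?P (g \<circ> transpose m j) \<in> funspace.span ?G" if j: "j \<in> D" for j
    proof (rule less.hyps)
      have jI: "j \<in> ?I" "m < j" using D j by auto
      have "(g \<circ> transpose m j) -` first_col = insert m (?I - {j})"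
        using jI m(2) by (auto simp: transpose_def split: if_splits)
      moreover have "\<Sum>(insert m (?I - {j})) < \<Sum>?I"
        using m(2) finI jI by (simp add: sum.remove[of ?I j])
      ultimately show "\<Sum>((g \<circ> transpose m j) -` first_col) < \<Sum>?I" by simp
      have "transpose m j permutes {..<n}" using m(1) jI I by (intro permutes_swap_id) auto
      then show "g \<circ> transpose m j permutes {..<n}" using g by (rule permutes_compose)
    qed
    ultimately show ?thesis by (auto intro: funspace.span_sum)
  qed
  have dependent: "?P g \<in> funspace.span ?G" if "?I \<notin> indep (column_matroid v)"
  proof -
    have "alternate (g ` ?I) ?t = 0"
      by (rule alternate_dependent_columns) (use g I that n in auto)
    then have "alternate first_col ?t = 0" unfolding gI .
    then have "?P g = project 0" by (simp add: project_def alternate_zero)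
    then show ?thesis by (simp only: project_zero funspace.span_zero)
  qed
  consider (nbc) "?I \<in> nbc_family v k" | (zero) "0 \<notin> ?I"
    | (broken) m where "m < n" "insert m {i \<in> ?I. m < i} \<notin> indep (column_matroid v)"
    using I cardI n by (auto simp: nbc_family_def)
  then show ?case
  proof cases
    case nbc
    then show ?thesis using g by (auto intro!: funspace.span_base)
  next
    case zero
    have "0 < n" using k_pos k_le by simp
    then have "g 0 < n" "g 0 \<notin> first_col"
      using zero permutes_in_image[OF g, of 0] by auto
    note \<open>0 < n\<close>
    moreover have "0 < j" if "j \<in> ?I" for j using zero that by (cases j) auto
    moreover have "project (\<Sum>d\<in>g ` ?I. permute_factors (transpose (g 0) d) ?t) = ?P g"
      unfolding gI using \<open>g 0 < n\<close> \<open>g 0 \<notin> first_col\<close> by (rule project_exchange_all)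
    ultimately show ?thesis using zero by (intro exchange[of 0 ?I]) auto
  next
    case (broken m)
    let ?D = "{i \<in> ?I. m < i}"
    show ?thesis
    proof (cases "m \<in> ?I")
      case True
      have "?I \<notin> indep (column_matroid v)"
      proof
        assume "?I \<in> indep (column_matroid v)"
        moreover have "insert m ?D \<subseteq> ?I" using True by auto
        ultimately have "insert m ?D \<in> indep (column_matroid v)" by (rule column_matroid_subset)
        then show False using broken(2) by simp
      qed
      then show ?thesis by (rule dependent)
    next
      case False
      have "alternate (g ` insert m ?D) ?t = 0"
        by (rule alternate_dependent_columns) (use g I broken n in auto)
      moreover have "g ` ?D \<subseteq> first_col" "g m \<notin> g ` ?D"
        using inj by (auto simp: inj_eq)
      ultimately have "project (\<Sum>d\<in>g ` ?D. permute_factors (transpose (g m) d) ?t) = ?P g"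
        by (intro project_exchange_dependent) auto
      then show ?thesis using False broken(1) by (intro exchange[of m ?D]) auto
    qed
  qed
qed


section \<open>Independence\<close>

text \<open>
  A space \<open>R\<close> of vectors stands for the row space of a matrix: a linear relation between columns is
  a relation between the coordinate functionals on \<open>R\<close>. Contracting a column amounts to passing to
  the subspace where its coordinate vanishes, and deleting a column leaves \<open>R\<close> unchanged.
\<close>

definition functionals_independent :: "(nat \<Rightarrow> 'k::field) set \<Rightarrow> nat set \<Rightarrow> bool" where
  "functionals_independent R I \<longleftrightarrow>
     (\<forall>c. (\<forall>x\<in>R. (\<Sum>j\<in>I. c j * x j) = 0) \<longrightarrow> (\<forall>j\<in>I. c j = 0))"

definition flag_independent :: "(nat \<Rightarrow> 'k::field) set \<Rightarrow> nat \<Rightarrow> nat set \<Rightarrow> bool" where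
  "flag_independent R n I \<longleftrightarrow> (\<forall>m<n. functionals_independent R (insert m {i \<in> I. m < i}))"

text \<open>
  Up to sign the sum is the determinant of the entries \<open>x p j\<close> with \<open>p \<in> B\<close> and \<open>j \<in> I\<close>, its rows and
  columns being matched by a bijection \<open>g\<close> from \<open>I\<close> to \<open>B\<close>. The row \<open>z\<close> is also evaluated at the
  columns outside \<open>I\<close>.
\<close>

definition det_form ::
  "nat \<Rightarrow> 'p \<Rightarrow> 'p set \<Rightarrow> nat set \<Rightarrow> (nat \<Rightarrow> 'p) \<Rightarrow> ('p \<Rightarrow> nat \<Rightarrow> 'k::field) \<Rightarrow> 'k" where
  "det_form n z B I g x = (\<Prod>j\<in>{..<n} - I. x z j) *
     (\<Sum>q | q permutes B. of_int (sign q) * (\<Prod>j\<in>I. x (q (g j)) j))"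

lemma det_form_transpose:
  assumes B: "finite B" and p: "p permutes B"
  shows "det_form n z B I g x = of_int (sign p) * det_form n z B I (\<lambda>j. p (g j)) x"
proof -
  have "(\<Sum>q | q permutes B. of_int (sign q) * (\<Prod>j\<in>I. x (q (g j)) j)) = 
      of_int (sign p) * (\<Sum>q | q permutes B. of_int (sign q) * (\<Prod>j\<in>I. x (q (p (g j))) j))" (is "?L = _ * ?R")
  proof -
    have "?L = of_int (sign p * sign p) * ?L" by simp
    also have "?R = of_int (sign p) * ?L"
    proof -
      have "?L = (\<Sum>q | q permutes B. of_int (sign (q \<circ> p)) * (\<Prod>j\<in>I. x ((q \<circ> p) (g j)) j))"
        by (rule sum_permutations_compose_right[OF p])
      also have "\<dots> = (\<Sum>q | q permutes B. of_int (sign p) * (of_int (sign q) * (\<Prod>j\<in>I. x (q (p (g j))) j)))"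
      proof (rule sum.cong[OF refl])
        fix q assume "q \<in> {q. q permutes B}"
        then have "sign (q \<circ> p) = sign q * sign p"
          using B p permutes_imp_permutation by (intro sign_compose) auto
        then show "of_int (sign (q \<circ> p)) * (\<Prod>j\<in>I. x ((q \<circ> p) (g j)) j) =
          of_int (sign p) * (of_int (sign q) * (\<Prod>j\<in>I. x (q (p (g j))) j))" by simp
      qed
      finally have L: "?L = of_int (sign p) * ?R" by (simp add: sum_distrib_left)
      have "of_int (sign p) * ?L = of_int (sign p * sign p) * ?R" unfolding L by (simp only: of_int_mult mult.assoc)
      then show ?thesis by simp
    qed
    then have "of_int (sign p) * ?R = of_int (sign p * sign p) * ?L" by (simp only: of_int_mult mult.assoc)
    then show ?thesis by simp
  qed
  then show ?thesis by (simp add: det_form_def)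
qed

definition polynomial_fun :: "('k::comm_ring_1 \<Rightarrow> 'k) \<Rightarrow> bool" where
  "polynomial_fun f \<longleftrightarrow> (\<exists>p. \<forall>s. f s = poly p s)"

lemma polynomial_fun_linear: "polynomial_fun (\<lambda>s. a + s * b)"
  unfolding polynomial_fun_def by (intro exI[of _ "[:a, b:]"]) simp

lemma polynomial_fun_const: "polynomial_fun (\<lambda>s. a)"
  unfolding polynomial_fun_def by (intro exI[of _ "[:a:]"]) simp

lemma polynomial_fun_mult:
  assumes "polynomial_fun f" "polynomial_fun g"
  shows "polynomial_fun (\<lambda>s. f s * g s)"
proof -
  obtain p q where "\<forall>s. f s = poly p s" "\<forall>s. g s = poly q s"
    using assms unfolding polynomial_fun_def by blast
  then show ?thesis unfolding polynomial_fun_def by (intro exI[of _ "p * q"]) simp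
qed

lemma polynomial_fun_add:
  assumes "polynomial_fun f" "polynomial_fun g"
  shows "polynomial_fun (\<lambda>s. f s + g s)"
proof -
  obtain p q where "\<forall>s. f s = poly p s" "\<forall>s. g s = poly q s"
    using assms unfolding polynomial_fun_def by blast
  then show ?thesis unfolding polynomial_fun_def by (intro exI[of _ "p + q"]) simp
qed

lemma polynomial_fun_sum: "(\<And>i. i \<in> I \<Longrightarrow> polynomial_fun (f i)) \<Longrightarrow> polynomial_fun (\<lambda>s. \<Sum>i\<in>I. f i s)"
  by (induction I rule: infinite_finite_induct) (auto intro: polynomial_fun_const polynomial_fun_add)

lemma polynomial_fun_prod: "(\<And>i. i \<in> I \<Longrightarrow> polynomial_fun (f i)) \<Longrightarrow> polynomial_fun (\<lambda>s. \<Prod>i\<in>I. f i s)"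
  by (induction I rule: infinite_finite_induct) (auto intro: polynomial_fun_const polynomial_fun_mult)

text \<open>
  A polynomial that vanishes off the zero of a nonconstant linear factor vanishes everywhere. This
  replaces the density of the complement of a hyperplane.
\<close>

lemma polynomial_fun_zero_factor:
  fixes f :: "'k::field_char_0 \<Rightarrow> 'k"
  assumes f: "polynomial_fun f" and zero: "\<And>s. (a + s * b) * f s = 0" and b: "b \<noteq> 0"
  shows "f s = 0"
proof -
  obtain p where p: "\<forall>s. f s = poly p s" using f unfolding polynomial_fun_def by blast
  have "poly ([:a, b:] * p) s = 0" for s using zero[of s] p by (simp add: algebra_simps)
  then have "[:a, b:] * p = 0" by (meson poly_all_0_iff_0)
  then have "[:a, b:] = 0 \<or> p = 0" by (simp only: mult_eq_0_iff)
  then have "p = 0" using b by simp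
  then show ?thesis using p by simp
qed

lemma polynomial_fun_det_form:
  fixes x :: "'p \<Rightarrow> nat \<Rightarrow> 'k::field"
  shows "polynomial_fun (\<lambda>s. det_form n z B I g (x(z := \<lambda>j. x z j + s * y j)))"
proof -
  have lin: "polynomial_fun (\<lambda>s. (x(z := \<lambda>j. x z j + s * y j)) b j)" for b j
    by (cases "b = z") (auto intro: polynomial_fun_linear polynomial_fun_const)
  show ?thesis
    unfolding det_form_def
    by (intro polynomial_fun_mult polynomial_fun_prod polynomial_fun_sum polynomial_fun_const lin)
qed

text \<open>
  A relation on the hyperplane \<open>x n = 0\<close> of \<open>R\<close> extends to a relation on \<open>R\<close> with a suitable
  coefficient at \<open>n\<close>, found by evaluation at \<open>y\<close>.
\<close>

lemma functionals_independent_contract: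
  assumes R: "funspace.subspace R" and y: "y \<in> R" "y n = 1"
    and ind: "functionals_independent R (insert n I)" and n: "n \<notin> I" and fin: "finite I"
  shows "functionals_independent {x \<in> R. x n = 0} I"
  unfolding functionals_independent_def
proof (intro allI impI ballI)
  fix c j assume c: "\<forall>x\<in>{x \<in> R. x n = 0}. (\<Sum>j\<in>I. c j * x j) = 0" and j: "j \<in> I"
  let ?s = "\<Sum>j\<in>I. c j * y j"
  let ?c = "c(n := - ?s)"
  have "(\<Sum>j\<in>insert n I. ?c j * x j) = 0" if x: "x \<in> R" for x
  proof -
    let ?x = "x - fun_scale (x n) y"
    have "?x \<in> R" using R x y by (intro funspace.subspace_diff funspace.subspace_scale)
    moreover have "?x n = 0" using y(2) by (simp add: fun_scale_def)
    ultimately have "(\<Sum>j\<in>I. c j * ?x j) = 0" using c by blast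
    moreover have "(\<Sum>j\<in>I. c j * ?x j) = (\<Sum>j\<in>I. c j * x j) - x n * ?s"
      by (simp add: fun_scale_def sum_subtractf sum_distrib_left algebra_simps)
    moreover have "(\<Sum>j\<in>I. ?c j * x j) = (\<Sum>j\<in>I. c j * x j)"
      using n by (intro sum.cong) auto
    ultimately show ?thesis using n fin by (simp add: algebra_simps)
  qed
  then have "\<forall>j\<in>insert n I. ?c j = 0"
    using ind unfolding functionals_independent_def by blast
  then show "c j = 0" using j n by (auto split: if_splits)
qed

lemma flag_independent_contract:
  assumes R: "funspace.subspace R" and y: "y \<in> R" "y n = 1"
    and I: "I \<subseteq> {..<Suc n}" "n \<in> I" and flag: "flag_independent R (Suc n) I"
  shows "flag_independent {x \<in> R. x n = 0} n (I - {n})"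
  unfolding flag_independent_def
proof (intro allI impI)
  fix m assume m: "m < n"
  let ?J = "insert m {i \<in> I - {n}. m < i}"
  have "insert n ?J = insert m {i \<in> I. m < i}" using m I(2) by auto
  then have "functionals_independent R (insert n ?J)"
    using flag m by (simp add: flag_independent_def)
  moreover have "finite ?J" using finite_subset[OF I(1)] by simp
  moreover have "n \<notin> ?J" using m by auto
  ultimately show "functionals_independent {x \<in> R. x n = 0} ?J"
    using functionals_independent_contract[OF R y] by blast
qed

text \<open>
  If the column \<open>n\<close> of the determinant is a unit vector, with its \<open>1\<close> in the row \<open>b\<close>, expansion along
  it leaves the minor without this row and this column.
\<close>

lemma det_form_contract:
  fixes x :: "'p \<Rightarrow> nat \<Rightarrow> 'k::field"
  assumes B: "finite B" "b \<in> B" "z \<noteq> b" and I: "I \<subseteq> {..<Suc n}" "n \<in> I" and g: "bij_betw g I B" "g n = b"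
    and y: "y n = 1" and x: "\<And>p. p \<in> B - {b} \<Longrightarrow> x p n = 0"
  shows "det_form (Suc n) z B I g (x(b := y)) = det_form n z (B - {b}) (I - {n}) g x"
proof -
  have finI: "finite I" using I(1) by (rule finite_subset) simp
  have gI: "g j \<in> B - {b}" if "j \<in> I - {n}" for j
  proof -
    have "g j \<in> B" using g(1) that by (auto simp: bij_betw_def)
    moreover have "g j \<noteq> g n" using g(1) that I(2) by (auto simp: bij_betw_def inj_on_eq_iff)
    ultimately show ?thesis using g(2) by simp
  qed
  let ?x = "x(b := y)"
  let ?f = "\<lambda>q. of_int (sign q) * (\<Prod>j\<in>I. ?x (q (g j)) j)"
  have "(\<Sum>q | q permutes B. ?f q) = (\<Sum>q | q permutes B - {b}. ?f q)"
  proof (rule sum.mono_neutral_right)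
    show "{q. q permutes B - {b}} \<subseteq> {q. q permutes B}"
      using permutes_subset[of _ "B - {b}" B] by auto
    show "\<forall>q\<in>{q. q permutes B} - {q. q permutes B - {b}}. ?f q = 0"
    proof
      fix q assume "q \<in> {q. q permutes B} - {q. q permutes B - {b}}"
      then have q: "q permutes B" "\<not> q permutes B - {b}" by auto
      have "q b \<noteq> b"
      proof
        assume "q b = b"
        then have "q permutes B - {b}" by (intro permutes_superset[OF q(1)]) auto
        then show False using q(2) by simp
      qed
      then have "?x (q (g n)) n = 0"
        using x[of "q b"] permutes_in_image[OF q(1), of b] B(2) g(2) by simp
      then have "\<exists>j\<in>I. ?x (q (g j)) j = 0" using I(2) by (rule bexI)
      from prod_zero[OF finI this] show "?f q = 0" by (simp only: mult_zero_right)
    qed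
  qed (use B(1) in \<open>simp add: finite_permutations\<close>)
  also have "\<dots> = (\<Sum>q | q permutes B - {b}. of_int (sign q) * (\<Prod>j\<in>I - {n}. x (q (g j)) j))"
  proof (rule sum.cong[OF refl])
    fix q assume "q \<in> {q. q permutes B - {b}}"
    then have q: "q permutes B - {b}" by simp
    have "q (g n) = b" using permutes_not_in[OF q, of b] g(2) by simp
    then have "(\<Prod>j\<in>I. ?x (q (g j)) j) = (\<Prod>j\<in>I - {n}. ?x (q (g j)) j)"
      using finI I(2) y by (simp add: prod.remove)
    also have "\<dots> = (\<Prod>j\<in>I - {n}. x (q (g j)) j)"
    proof (rule prod.cong[OF refl])
      fix j assume "j \<in> I - {n}"
      then have "q (g j) \<in> B - {b}" using gI permutes_in_image[OF q] by blast
      then show "?x (q (g j)) j = x (q (g j)) j" by simp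
    qed
    finally show "?f q = of_int (sign q) * (\<Prod>j\<in>I - {n}. x (q (g j)) j)" by simp
  qed
  moreover have "{..<Suc n} - I = {..<n} - (I - {n})" using I by (auto simp: less_Suc_eq)
  ultimately show ?thesis using B(3) by (simp add: det_form_def)
qed

lemma det_form_delete:
  assumes "I \<subseteq> {..<Suc n}" "n \<notin> I"
  shows "det_form (Suc n) z B I g x = x z n * det_form n z B I g x"
proof -
  have "{..<Suc n} - I = insert n ({..<n} - I)" using assms by auto
  then show ?thesis by (simp add: det_form_def)
qed

text \<open>
  Induction on the number of columns. For the sets that contain the last column \<open>n\<close>, choose the row
  \<open>b \<noteq> z\<close> with entry \<open>1\<close> at \<open>n\<close> and all other rows, in particular the row \<open>z\<close>, with entry \<open>0\<close> there.
  The sets without \<open>n\<close> then contribute a zero factor \<open>x z n\<close>, and on the others the forms become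
  those of the contraction. So the coefficients of the sets that contain \<open>n\<close> vanish. For the
  remaining sets the factor \<open>x z n\<close> is cancelled along a line in the direction of \<open>y\<close>. The flag
  condition enters twice: it provides \<open>y\<close>, since the last column is not zero, and it passes to the
  contraction, since \<open>n\<close> lies above every other element. The element \<open>0\<close> ensures that
  \<open>B\<close> has an element \<open>b \<noteq> z\<close> as soon as some set contains \<open>n > 0\<close>.
\<close>

lemma det_forms_independent:
  fixes R :: "(nat \<Rightarrow> 'k::field_char_0) set" and coef :: "'i \<Rightarrow> 'k" and B :: "'p set"
  assumes "funspace.subspace R" "finite B" "z \<in> B" "finite S" "inj_on I S"
    and "\<And>s. s \<in> S \<Longrightarrow> I s \<subseteq> {..<n} \<and> 0 \<in> I s \<and> bij_betw (g s) (I s) B \<and> flag_independent R n (I s)"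
    and "\<And>x. (\<And>b. b \<in> B \<Longrightarrow> x b \<in> R) \<Longrightarrow> (\<Sum>s\<in>S. coef s * det_form n z B (I s) (g s) x) = 0"
    and "s \<in> S"
  shows "coef s = 0"
  using assms
proof (induction n arbitrary: R B S I g coef s)
  case 0
  then show ?case by fastforce
next
  case (Suc n)
  note R = Suc.prems(1) and B = Suc.prems(2) and z = Suc.prems(3) and S = Suc.prems(4) and inj = Suc.prems(5)
    and sum0 = Suc.prems(7)
  have I: "I s \<subseteq> {..<Suc n}" "0 \<in> I s" "bij_betw (g s) (I s) B" "flag_independent R (Suc n) (I s)"
    if "s \<in> S" for s using Suc.prems(6)[OF that] by auto
  have finI: "finite (I s)" if "s \<in> S" for s using I(1)[OF that] by (rule finite_subset) simp
  obtain y where y: "y \<in> R" "y n = 1"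
  proof -
    have "functionals_independent R (insert n {i \<in> I s. n < i})"
      using I(4)[OF Suc.prems(8)] by (simp add: flag_independent_def)
    moreover have "{i \<in> I s. n < i} = {}" using I(1)[OF Suc.prems(8)] by auto
    ultimately have "\<not> (\<forall>x\<in>R. (\<Sum>j\<in>{n}. 1 * x j) = 0)"
      unfolding functionals_independent_def by (auto dest: spec[of _ "\<lambda>_. 1"])
    then obtain x where x: "x \<in> R" "x n \<noteq> 0" by auto
    show ?thesis
    proof (rule that)
      show "fun_scale (1 / x n) x \<in> R" using R x(1) by (rule funspace.subspace_scale)
      show "fun_scale (1 / x n) x n = 1" using x(2) by (simp add: fun_scale_def)
    qed
  qed
  show ?case
  proof (cases "n = 0")
    case True
    have I0: "I s = {0}" if "s \<in> S" for s using I(1,2)[OF that] True by auto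
    have "S = {s}" using inj Suc.prems(8) I0 by (auto simp: inj_on_def)
    moreover have "B = {z}"
      using I(3)[OF Suc.prems(8)] I0[OF Suc.prems(8)] z by (auto simp: bij_betw_def)
    moreover have "g s 0 = z"
      using I(3)[OF Suc.prems(8)] I0[OF Suc.prems(8)] \<open>B = {z}\<close> by (auto simp: bij_betw_def)
    ultimately show ?thesis
      using sum0[of "\<lambda>_. y"] y True I0[OF Suc.prems(8)] by (simp add: det_form_def)
  next
    case n0: False
    define S1 where "S1 = {s \<in> S. n \<in> I s}"
    have S1: "s \<in> S" "n \<in> I s" if "s \<in> S1" for s using that by (auto simp: S1_def)
    have contracted: "coef s = 0" if s1: "s \<in> S1" for s
    proof -
      have "card B = card (I s)" using I(3)[OF S1(1)[OF s1]] by (simp add: bij_betw_same_card)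
      moreover have "card {0, n} \<le> card (I s)"
        using I(2)[OF S1(1)[OF s1]] S1(2)[OF s1] finI[OF S1(1)[OF s1]] by (intro card_mono) auto
      ultimately have "B \<noteq> {z}" using n0 by auto
      then obtain b where b: "b \<in> B" "b \<noteq> z" using z by blast
      \<comment> \<open>reindexing by \<tau> s matches the last column with the same row b for every s; it costs a sign\<close>
      define \<tau> where "\<tau> s = transpose (g s n) b" for s
      have gn: "g s n \<in> B" if "s \<in> S1" for s using I(3) S1[OF that] by (auto simp: bij_betw_def)
      have \<tau>: "\<tau> s permutes B" if "s \<in> S1" for s
        unfolding \<tau>_def using gn[OF that] b(1) by (rule permutes_swap_id)
      define h where "h s = (\<lambda>j. \<tau> s (g s j))" for s
      have h: "bij_betw (h s) (I s) B" if "s \<in> S1" for s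
        using bij_betw_trans[OF I(3)[OF S1(1)[OF that]] permutes_imp_bij[OF \<tau>[OF that]]]
        by (simp add: h_def o_def)
      have hn: "h s n = b" for s by (simp add: h_def \<tau>_def)
      let ?R = "{x \<in> R. x n = 0}"
      have "of_int (sign (\<tau> s)) * coef s = 0"
      proof (rule Suc.IH[where R = ?R and B = "B - {b}" and S = S1 and I = "\<lambda>s. I s - {n}" and g = h
            and coef = "\<lambda>s. of_int (sign (\<tau> s)) * coef s" and s = s])
        show "funspace.subspace ?R"
          by (intro funspace.subspaceI)
            (simp_all add: funspace.subspace_0[OF R] funspace.subspace_add[OF R] funspace.subspace_scale[OF R] fun_scale_def[THEN fun_cong])
        show "finite (B - {b})" "z \<in> B - {b}" "finite S1" "s \<in> S1"
          using B z b s1 S by (auto simp: S1_def)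
        show "inj_on (\<lambda>s. I s - {n}) S1"
        proof (rule inj_onI)
          fix s t assume st: "s \<in> S1" "t \<in> S1" "I s - {n} = I t - {n}"
          then have "I s = I t" using S1(2)[OF st(1)] S1(2)[OF st(2)] by blast
          then show "s = t" using inj st S1(1) by (auto simp: inj_on_def)
        qed
      next
        fix t assume t: "t \<in> S1"
        have "bij_betw (h t) (I t - {n}) (B - {b})"
        proof -
          have inj: "inj_on (h t) (I t)" and img: "h t ` I t = B" using h[OF t] by (auto simp: bij_betw_def)
          have "h t ` (I t - {n}) = h t ` I t - h t ` {n}"
            using S1(2)[OF t] by (intro inj_on_image_set_diff[OF inj]) auto
          then show ?thesis
            using inj img by (auto simp: bij_betw_def hn intro: inj_on_subset)
        qed
        then show "I t - {n} \<subseteq> {..<n} \<and> 0 \<in> I t - {n} \<and> bij_betw (h t) (I t - {n}) (B - {b}) \<and>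
            flag_independent ?R n (I t - {n})"
          using I[OF S1(1)[OF t]] S1(2)[OF t] n0 flag_independent_contract[OF R y]
          by (auto simp: less_Suc_eq)
      next
        fix x :: "'p \<Rightarrow> nat \<Rightarrow> 'k" assume x: "\<And>p. p \<in> B - {b} \<Longrightarrow> x p \<in> ?R"
        let ?x = "x(b := y)"
        have "?x p \<in> R" if "p \<in> B" for p using x that y(1) by (cases "p = b") auto
        then have "0 = (\<Sum>s\<in>S. coef s * det_form (Suc n) z B (I s) (g s) ?x)" using sum0 by simp
        also have "\<dots> = (\<Sum>s\<in>S1. coef s * det_form (Suc n) z B (I s) (g s) ?x)"
        proof (rule sum.mono_neutral_right[OF S])
          show "\<forall>s\<in>S - S1. coef s * det_form (Suc n) z B (I s) (g s) ?x = 0"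
          proof
            fix s assume s: "s \<in> S - S1"
            then have "det_form (Suc n) z B (I s) (g s) ?x = ?x z n * det_form n z B (I s) (g s) ?x"
              using I(1) by (intro det_form_delete) (auto simp: S1_def)
            moreover have "?x z n = 0" using x[of z] z b by auto
            ultimately show "coef s * det_form (Suc n) z B (I s) (g s) ?x = 0" by simp
          qed
        qed (auto simp: S1_def)
        also have "\<dots> = (\<Sum>s\<in>S1. of_int (sign (\<tau> s)) * coef s * det_form n z (B - {b}) (I s - {n}) (h s) x)"
        proof (rule sum.cong[OF refl])
          fix s assume s: "s \<in> S1"
          have "det_form (Suc n) z B (I s) (g s) ?x = of_int (sign (\<tau> s)) * det_form (Suc n) z B (I s) (h s) ?x"
            unfolding h_def by (rule det_form_transpose[OF B \<tau>[OF s]])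
          also have "det_form (Suc n) z B (I s) (h s) ?x = det_form n z (B - {b}) (I s - {n}) (h s) x"
            by (rule det_form_contract[of B b z "I s" n "h s" y x]) (use B b I S1[OF s] h[OF s] hn y(2) x in auto)
          finally show "coef s * det_form (Suc n) z B (I s) (g s) ?x =
            of_int (sign (\<tau> s)) * coef s * det_form n z (B - {b}) (I s - {n}) (h s) x"
            by (simp only: mult.assoc mult.left_commute)
        qed
        finally show "(\<Sum>s\<in>S1. of_int (sign (\<tau> s)) * coef s * det_form n z (B - {b}) (I s - {n}) (h s) x) = 0" by simp
      qed
      then show ?thesis by simp
    qed
    show ?thesis
    proof (cases "s \<in> S1")
      case True
      then show ?thesis by (rule contracted)
    next
      case False
      let ?S = "S - S1"
      show ?thesis
      proof (rule Suc.IH[where R = R and B = B and S = ?S and I = I and g = g and coef = coef and s = s])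
        show "inj_on I ?S" using inj by (rule inj_on_subset) auto
        fix t assume "t \<in> ?S"
        then have "t \<in> S" "n \<notin> I t" by (auto simp: S1_def)
        then show "I t \<subseteq> {..<n} \<and> 0 \<in> I t \<and> bij_betw (g t) (I t) B \<and> flag_independent R n (I t)"
          using I[OF \<open>t \<in> S\<close>] by (auto simp: less_Suc_eq flag_independent_def)
      next
        fix x :: "'p \<Rightarrow> nat \<Rightarrow> 'k" assume x: "\<And>b. b \<in> B \<Longrightarrow> x b \<in> R"
        let ?x = "\<lambda>a. x(z := \<lambda>j. x z j + a * y j)"
        let ?f = "\<lambda>a. \<Sum>s\<in>?S. coef s * det_form n z B (I s) (g s) (?x a)"
        have "(x z n + a * 1) * ?f a = 0" for a
        proof -
          have "(\<lambda>j. x z j + a * y j) = x z + fun_scale a y" by (auto simp: fun_scale_def)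
          then have "(\<lambda>j. x z j + a * y j) \<in> R"
            using R x[OF z] y(1) by (simp add: funspace.subspace_add funspace.subspace_scale)
          then have "?x a b \<in> R" if "b \<in> B" for b using x[OF that] by (cases "b = z") auto
          from sum0[of "?x a", OF this] have "0 = (\<Sum>s\<in>S. coef s * det_form (Suc n) z B (I s) (g s) (?x a))"
            by (rule sym)
          also have "\<dots> = (\<Sum>s\<in>?S. coef s * det_form (Suc n) z B (I s) (g s) (?x a))"
            by (rule sum.mono_neutral_right[OF S]) (auto simp: contracted)
          also have "\<dots> = (\<Sum>s\<in>?S. (x z n + a * 1) * (coef s * det_form n z B (I s) (g s) (?x a)))"
          proof (rule sum.cong[OF refl])
            fix s assume "s \<in> ?S"
            then have "det_form (Suc n) z B (I s) (g s) (?x a) = ?x a z n * det_form n z B (I s) (g s) (?x a)"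
              using I(1) by (intro det_form_delete) (auto simp: S1_def)
            then show "coef s * det_form (Suc n) z B (I s) (g s) (?x a) =
                (x z n + a * 1) * (coef s * det_form n z B (I s) (g s) (?x a))" by (simp add: y(2))
          qed
          finally show ?thesis by (simp add: sum_distrib_left)
        qed
        moreover have "polynomial_fun ?f"
          by (intro polynomial_fun_sum polynomial_fun_mult polynomial_fun_const polynomial_fun_det_form)
        ultimately have "?f 0 = 0" by (intro polynomial_fun_zero_factor[of ?f "x z n" 1]) auto
        then show "(\<Sum>s\<in>?S. coef s * det_form n z B (I s) (g s) x) = 0" by simp
      qed (use R B z S False Suc.prems(8) in auto)
    qed
  qed
qed


section \<open>The dimension of the image of the Young symmetrizer\<close>

lemma det_form_cong:
  assumes "z \<in> B" "\<And>p. p \<in> B \<Longrightarrow> x p = x' p" "\<And>j. j \<in> I \<Longrightarrow> g j \<in> B"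
  shows "det_form n z B I g x = det_form n z B I g x'"
proof -
  have "(\<Sum>q | q permutes B. of_int (sign q) * (\<Prod>j\<in>I. x (q (g j)) j)) =
      (\<Sum>q | q permutes B. of_int (sign q) * (\<Prod>j\<in>I. x' (q (g j)) j))"
  proof (rule sum.cong[OF refl])
    fix q assume "q \<in> {q. q permutes B}"
    then have "q (g j) \<in> B" if "j \<in> I" for j using that assms(3) permutes_in_image[of q B] by blast
    then have "(\<Prod>j\<in>I. x (q (g j)) j) = (\<Prod>j\<in>I. x' (q (g j)) j)"
      using assms(2) by (intro prod.cong) auto
    then show "of_int (sign q) * (\<Prod>j\<in>I. x (q (g j)) j) = of_int (sign q) * (\<Prod>j\<in>I. x' (q (g j)) j)" by simp
  qed
  then show ?thesis using assms(1,2) by (simp add: det_form_def)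
qed

definition row_combination :: "'k::field mat \<Rightarrow> (nat \<Rightarrow> 'k) \<Rightarrow> nat \<Rightarrow> 'k" where
  "row_combination v y = (\<lambda>j. \<Sum>a<dim_row v. y a * v $$ (a, j))"

lemma subspace_row_combinations: "funspace.subspace (range (row_combination v))"
proof (rule funspace.subspaceI)
  have "row_combination v (\<lambda>_. 0) = 0" by (simp add: row_combination_def fun_eq_iff)
  then show "0 \<in> range (row_combination v)" using rangeI[of "row_combination v" "\<lambda>_. 0"] by (simp only:)
next
  fix x x' assume "x \<in> range (row_combination v)" "x' \<in> range (row_combination v)"
  then obtain y y' where "x = row_combination v y" "x' = row_combination v y'" by (elim imageE)
  then have "row_combination v (\<lambda>a. y a + y' a) = x + x'"
    by (simp add: row_combination_def fun_eq_iff sum.distrib algebra_simps)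
  then show "x + x' \<in> range (row_combination v)"
    using rangeI[of "row_combination v" "\<lambda>a. y a + y' a"] by (simp only:)
next
  fix c x assume "x \<in> range (row_combination v)"
  then obtain y where "x = row_combination v y" by (elim imageE)
  then have "row_combination v (\<lambda>a. c * y a) = fun_scale c x"
    by (simp add: row_combination_def fun_eq_iff fun_scale_apply sum_distrib_left mult.assoc)
  then show "fun_scale c x \<in> range (row_combination v)"
    using rangeI[of "row_combination v" "\<lambda>a. c * y a"] by (simp only:)
qed

lemma functionals_independent_columns:
  assumes "I \<in> indep (column_matroid v)"
  shows "functionals_independent (range (row_combination v)) I"
  unfolding functionals_independent_def
proof (intro allI impI)
  fix c assume c: "\<forall>x\<in>range (row_combination v). (\<Sum>j\<in>I. c j * x j) = 0"
  have "(\<Sum>j\<in>I. c j * v $$ (a, j)) = 0" if a: "a < dim_row v" for a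
  proof -
    have "row_combination v (\<lambda>b. if b = a then 1 else 0) = (\<lambda>j. v $$ (a, j))"
    proof
      fix j
      have "row_combination v (\<lambda>b. if b = a then 1 else 0) j = (\<Sum>b<dim_row v. if b = a then v $$ (b, j) else 0)"
        unfolding row_combination_def by (rule sum.cong) auto
      then show "row_combination v (\<lambda>b. if b = a then 1 else 0) j = v $$ (a, j)" using a by simp
    qed
    then show ?thesis using bspec[OF c rangeI, of "\<lambda>b. if b = a then 1 else 0"] by simp
  qed
  then have "\<forall>a<dim_row v. (\<Sum>j\<in>I. c j * v $$ (a, j)) = 0" by blast
  moreover have "(\<forall>a<dim_row v. (\<Sum>j\<in>I. c j * v $$ (a, j)) = 0) \<longrightarrow> (\<forall>j\<in>I. c j = 0)"
    using assms by (simp add: column_matroid_def)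
  ultimately show "\<forall>j\<in>I. c j = 0" by blast
qed

text \<open>
  The value of the multilinear form \<open>T\<close> at covectors \<open>y 0, \<dots>, y (n - 1)\<close>.
\<close>

definition tensor_pairing :: "nat \<Rightarrow> nat \<Rightarrow> (nat \<Rightarrow> nat \<Rightarrow> 'k::field) \<Rightarrow> ((nat \<Rightarrow> nat) \<Rightarrow> 'k) \<Rightarrow> 'k" where
  "tensor_pairing r n y T = (\<Sum>w\<in>tensor_words r n. (\<Prod>i<n. y i (w i)) * T w)"

lemma tensor_pairing_column_tensor:
  assumes n: "dim_col v = n" and \<tau>: "\<tau> permutes {..<n}"
  shows "tensor_pairing (dim_row v) n y (permute_factors \<tau> (column_tensor v)) =
    (\<Prod>j<n. row_combination v (y (\<tau> j)) j)"
proof -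
  let ?r = "dim_row v" and ?\<tau> = "inv_into UNIV \<tau>"
  have "tensor_pairing ?r n y (permute_factors \<tau> (column_tensor v)) =
      (\<Sum>w\<in>tensor_words ?r n. \<Prod>i<n. y i (w i) * v $$ (w i, ?\<tau> i))"
    unfolding tensor_pairing_def column_tensor_eq n permute_factors_tensor[OF \<tau>]
    by (rule sum.cong[OF refl]) (simp add: tensor_def prod.distrib)
  also have "\<dots> = (\<Prod>i<n. \<Sum>a<?r. y i a * v $$ (a, ?\<tau> i))"
    unfolding tensor_words_def by (rule prod_sum_PiE[symmetric]) auto
  also have "\<dots> = (\<Prod>j<n. row_combination v (y (\<tau> j)) j)"
    using prod.permute[OF \<tau>, of "\<lambda>i. \<Sum>a<?r. y i a * v $$ (a, ?\<tau> i)"]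
    by (simp add: o_def permutes_inverses[OF \<tau>] row_combination_def)
  finally show ?thesis .
qed

context hook_shape
begin

text \<open>
  With the same covector at all positions of the first row, the symmetrization over the row is a
  multiplication by its number of permutations, and the columns not in \<open>I\<close> give the factors
  outside the determinant.
\<close>

lemma tensor_pairing_project:
  fixes v :: "'k::field_char_0 mat"
  assumes n: "dim_col v = n" and g: "g permutes {..<n}"
    and y: "\<And>i. i \<in> first_row \<Longrightarrow> y i = y 0"
  shows "tensor_pairing (dim_row v) n y (project (permute_factors g (column_tensor v))) =
    of_nat (card {p. p permutes first_row}) *
      det_form n 0 first_col (g -` first_col) g (\<lambda>i. row_combination v (y i))"
proof -
  let ?R = "{p. p permutes first_row}" and ?C = "{q. q permutes first_col}"
  let ?I = "g -` first_col" and ?x = "\<lambda>i. row_combination v (y i)"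
  let ?t = "column_tensor v"
  have term_eq: "tensor_pairing (dim_row v) n y (permute_factors (p \<circ> q \<circ> g) ?t) =
      (\<Prod>j\<in>{..<n} - ?I. ?x 0 j) * (\<Prod>j\<in>?I. ?x (q (g j)) j)" if p: "p \<in> ?R" and q: "q \<in> ?C" for p q
  proof -
    have p': "p permutes first_row" and q': "q permutes first_col" using p q by auto
    have perm: "p \<circ> q \<circ> g permutes {..<n}"
      using g permutes_subset[OF p' first_row_subset] permutes_subset[OF q' first_col_subset]
      by (intro permutes_compose)
    have yp: "y (p i) = y i" for i
    proof (cases "i \<in> first_row")
      case True
      then have "p i \<in> first_row" using permutes_in_image[OF p'] by blast
      then show ?thesis using y True by metis
    next
      case False
      then show ?thesis using permutes_not_in[OF p'] by simp
    qed
    have I: "?I \<subseteq> {..<n}"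
    proof
      fix j assume "j \<in> ?I"
      then have "g j \<in> {..<n}" using first_col_subset by auto
      then show "j \<in> {..<n}" using permutes_in_image[OF g] by blast
    qed
    have rest: "y (q (g j)) = y 0" if "j \<in> {..<n} - ?I" for j
    proof -
      have "g j < n" "g j \<notin> first_col" using that permutes_in_image[OF g, of j] by auto
      then have "g j \<in> first_row" "q (g j) = g j" using in_row_iff permutes_not_in[OF q'] by auto
      then show ?thesis using y by simp
    qed
    have "tensor_pairing (dim_row v) n y (permute_factors (p \<circ> q \<circ> g) ?t) = (\<Prod>j<n. ?x (q (g j)) j)"
      unfolding tensor_pairing_column_tensor[OF n perm] by (simp add: yp)
    also have "\<dots> = (\<Prod>j\<in>{..<n} - ?I. ?x (q (g j)) j) * (\<Prod>j\<in>?I. ?x (q (g j)) j)"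
      by (rule prod.subset_diff[OF I]) simp
    also have "(\<Prod>j\<in>{..<n} - ?I. ?x (q (g j)) j) = (\<Prod>j\<in>{..<n} - ?I. ?x 0 j)"
      by (rule prod.cong[OF refl]) (simp only: rest)
    finally show ?thesis .
  qed
  have "project (permute_factors g ?t) w =
      (\<Sum>p\<in>?R. \<Sum>q\<in>?C. of_int (sign q) * permute_factors (p \<circ> q \<circ> g) ?t w)" for w
    by (simp add: project_def symmetrize_def alternate_def permute_factors_def o_assoc)
  then have "tensor_pairing (dim_row v) n y (project (permute_factors g ?t)) =
      (\<Sum>w\<in>tensor_words (dim_row v) n. \<Sum>p\<in>?R. \<Sum>q\<in>?C.
        of_int (sign q) * ((\<Prod>i<n. y i (w i)) * permute_factors (p \<circ> q \<circ> g) ?t w))"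
    unfolding tensor_pairing_def by (simp add: sum_distrib_left algebra_simps)
  also have "\<dots> = (\<Sum>p\<in>?R. \<Sum>q\<in>?C. of_int (sign q) *
      tensor_pairing (dim_row v) n y (permute_factors (p \<circ> q \<circ> g) ?t))"
    unfolding tensor_pairing_def sum_distrib_left
    by (subst sum.swap, rule sum.cong[OF refl], rule sum.swap)
  also have "\<dots> = (\<Sum>p\<in>?R. \<Sum>q\<in>?C. of_int (sign q) *
      ((\<Prod>j\<in>{..<n} - ?I. ?x 0 j) * (\<Prod>j\<in>?I. ?x (q (g j)) j)))"
    by (intro sum.cong refl) (simp only: term_eq)
  also have "\<dots> = of_nat (card ?R) * det_form n 0 first_col ?I g ?x"
    by (simp add: det_form_def sum_distrib_left algebra_simps)
  finally show ?thesis .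
qed

lemma exists_permutation_columns:
  assumes I: "I \<subseteq> {..<n}" "card I = k"
  shows "\<exists>g. g permutes {..<n} \<and> g -` first_col = I"
proof -
  have fin: "finite I" using I(1) by (rule finite_subset) simp
  obtain f1 where f1: "bij_betw f1 I first_col"
    using finite_same_card_bij[OF fin finite_first_col] I(2) card_first_col by auto
  obtain f2 where f2: "bij_betw f2 ({..<n} - I) ({..<n} - first_col)"
    using finite_same_card_bij[of "{..<n} - I" "{..<n} - first_col"] I fin card_first_col first_col_subset
    by (auto simp: card_Diff_subset)
  define g where "g x = (if x \<in> I then f1 x else if x < n then f2 x else x)" for x
  have "bij_betw g (I \<union> ({..<n} - I)) (first_col \<union> ({..<n} - first_col))"
  proof (rule bij_betw_combine)
    show "bij_betw g I first_col" using f1 by (rule bij_betw_cong[THEN iffD1, rotated]) (simp add: g_def)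
    show "bij_betw g ({..<n} - I) ({..<n} - first_col)"
      using f2 by (rule bij_betw_cong[THEN iffD1, rotated]) (simp add: g_def)
  qed auto
  moreover have "I \<union> ({..<n} - I) = {..<n}" "first_col \<union> ({..<n} - first_col) = {..<n}"
    using I(1) first_col_subset by auto
  ultimately have "bij_betw g {..<n} {..<n}" by simp
  then have "g permutes {..<n}"
    by (rule bij_imp_permutes) (use I(1) in \<open>auto simp: g_def\<close>)
  moreover have "g -` first_col = I"
  proof (intro equalityI subsetI)
    fix x assume x: "x \<in> g -` first_col"
    show "x \<in> I"
    proof (rule ccontr)
      assume "x \<notin> I"
      then have "g x \<in> {..<n} - first_col \<or> g x \<notin> {..<n}"
        using f2 by (cases "x < n") (auto simp: g_def bij_betw_def)
      then show False using x first_col_subset by auto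
    qed
  next
    fix x assume "x \<in> I"
    then show "x \<in> g -` first_col" using f1 by (auto simp: g_def bij_betw_def)
  qed
  ultimately show ?thesis by blast
qed

lemma nbc_tensors_independent:
  fixes v :: "'k::field_char_0 mat"
  assumes n: "dim_col v = n"
    and g: "\<And>I. I \<in> nbc_family v k \<Longrightarrow> g I permutes {..<n} \<and> g I -` first_col = I"
    and zero: "(\<Sum>I\<in>nbc_family v k. fun_scale (coef I) (project (permute_factors (g I) (column_tensor v)))) = 0"
    and I: "I \<in> nbc_family v k"
  shows "coef I = 0"
proof -
  let ?N = "nbc_family v k" and ?E = "\<lambda>I. project (permute_factors (g I) (column_tensor v))"
  have gI: "g I ` I = first_col" if "I \<in> ?N" for I
    using g[OF that] permutes_surj[of "g I"] surj_image_vimage_eq[of "g I" first_col] by metis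
  have bij: "bij_betw (g I) I first_col" if "I \<in> ?N" for I
    unfolding bij_betw_def using permutes_inj[OF conjunct1[OF g[OF that]]] gI[OF that]
    by (auto intro: inj_on_subset)
  show ?thesis
  proof (rule det_forms_independent[where R = "range (row_combination v)" and B = first_col and z = 0
        and S = ?N and I = "\<lambda>I. I" and n = n and g = g])
    show "funspace.subspace (range (row_combination v))" by (rule subspace_row_combinations)
    show "finite first_col" "0 \<in> first_col" by (simp_all add: zero_in_first_col)
    show "finite ?N" by (rule finite_subset[of _ "Pow {..<n}"]) (auto simp: nbc_family_def n)
    show "inj_on (\<lambda>I. I) ?N" by simp
    show "I \<in> ?N" by (rule I)
  next
    fix J assume J: "J \<in> ?N"
    then have "J \<subseteq> {..<n}" "0 \<in> J" "\<And>m. m < n \<Longrightarrow> insert m {i \<in> J. m < i} \<in> indep (column_matroid v)"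
      by (auto simp: nbc_family_def n)
    then show "J \<subseteq> {..<n} \<and> 0 \<in> J \<and> bij_betw (g J) J first_col \<and> flag_independent (range (row_combination v)) n J"
      using bij[OF J] by (auto simp: flag_independent_def functionals_independent_columns)
  next
    fix x :: "nat \<Rightarrow> nat \<Rightarrow> 'k" assume x: "\<And>b. b \<in> first_col \<Longrightarrow> x b \<in> range (row_combination v)"
    have "\<exists>y. x b = row_combination v y" if "b \<in> first_col" for b
      using x[OF that] by (elim imageE) (rule exI)
    then obtain y where y: "\<And>b. b \<in> first_col \<Longrightarrow> x b = row_combination v (y b)" by metis
    \<comment> \<open>repeat the covector of position 0 along the first row\<close>
    define Y where "Y i = (if i \<in> first_col then y i else y 0)" for i
    have Y0: "Y i = Y 0" if "i \<in> first_row" for i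
      using that first_row_subset zero_in_first_col in_row_iff[of i] by (auto simp: Y_def)
    have form_Y: "det_form n 0 first_col J (g J) x = det_form n 0 first_col J (g J) (\<lambda>i. row_combination v (Y i))"
      if "J \<in> ?N" for J
      by (rule det_form_cong) (use y zero_in_first_col gI[OF that] in \<open>auto simp: Y_def\<close>)
    let ?c = "of_nat (card {p. p permutes first_row}) :: 'k"
    have "0 = tensor_pairing (dim_row v) n Y (\<Sum>J\<in>?N. fun_scale (coef J) (?E J))"
      unfolding zero by (simp add: tensor_pairing_def)
    also have "\<dots> = (\<Sum>J\<in>?N. coef J * tensor_pairing (dim_row v) n Y (?E J))"
      unfolding tensor_pairing_def sum_fun_apply sum_distrib_left
      by (subst sum.swap) (simp add: fun_scale_apply algebra_simps)
    also have "\<dots> = (\<Sum>J\<in>?N. ?c * (coef J * det_form n 0 first_col J (g J) x))"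
    proof (rule sum.cong[OF refl])
      fix J assume J: "J \<in> ?N"
      have "tensor_pairing (dim_row v) n Y (?E J) = ?c * det_form n 0 first_col J (g J) x"
        using tensor_pairing_project[OF n conjunct1[OF g[OF J]], of Y] Y0 g[OF J] form_Y[OF J] by simp
      then show "coef J * tensor_pairing (dim_row v) n Y (?E J) = ?c * (coef J * det_form n 0 first_col J (g J) x)" by simp
    qed
    also have "\<dots> = ?c * (\<Sum>J\<in>?N. coef J * det_form n 0 first_col J (g J) x)"
      by (simp add: sum_distrib_left)
    finally show "(\<Sum>J\<in>?N. coef J * det_form n 0 first_col J (g J) x) = 0"
      using card_permutations[OF refl finite_first_row] by simp
  qed
qed

lemma dim_project_tensor_module:
  fixes v :: "'k::field_char_0 mat"
  assumes n: "dim_col v = n"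
  shows "funspace.dim (project ` tensor_module v) = card (nbc_family v k)"
proof -
  let ?N = "nbc_family v k" and ?t = "column_tensor v"
  have finN: "finite ?N" by (rule finite_subset[of _ "Pow {..<n}"]) (auto simp: nbc_family_def n)
  have "\<forall>I\<in>?N. \<exists>g. g permutes {..<n} \<and> g -` first_col = I"
    using exists_permutation_columns by (auto simp: nbc_family_def n)
  then obtain g where g: "\<And>I. I \<in> ?N \<Longrightarrow> g I permutes {..<n} \<and> g I -` first_col = I" by metis
  define E where "E I = project (permute_factors (g I) ?t)" for I
  have W: "tensor_module v = funspace.span {permute_factors \<sigma> ?t | \<sigma>. \<sigma> permutes {..<n}}"
    by (simp add: tensor_module_def cyclic_submodule_def n)
  have zero: "coef I = 0" if "(\<Sum>I\<in>?N. fun_scale (coef I) (E I)) = 0" "I \<in> ?N" for coef I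
    using nbc_tensors_independent[OF n g] that unfolding E_def by blast
  have fam: "inj_on E ?N" "funspace.independent (E ` ?N)"
    by (rule family_independent[OF finN]; erule (1) zero)+
  have "funspace.dim (project ` tensor_module v) = card (E ` ?N)"
  proof (rule funspace.dim_unique[OF _ _ fam(2) refl])
    show "E ` ?N \<subseteq> project ` tensor_module v"
      unfolding W E_def using g by (blast intro: funspace.span_base)
    have gen: "project (permute_factors \<sigma> ?t) \<in> funspace.span (E ` ?N)" if \<sigma>: "\<sigma> permutes {..<n}" for \<sigma>
    proof -
      have "{project (permute_factors g' ?t) | g'. g' permutes {..<n} \<and> g' -` first_col \<in> ?N}
          \<subseteq> funspace.span (E ` ?N)"
      proof clarify
        fix g' assume g': "g' permutes {..<n}" "g' -` first_col \<in> ?N"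
        let ?I = "g' -` first_col"
        obtain s where "project (permute_factors g' ?t) = fun_scale s (E ?I)"
          unfolding E_def using project_same_columns[of "g ?I" g'] g[OF g'(2)] g'(1) by metis
        then show "project (permute_factors g' ?t) \<in> funspace.span (E ` ?N)"
          using g'(2) by (simp add: funspace.span_scale funspace.span_base)
      qed
      then have "funspace.span {project (permute_factors g' ?t) | g'. g' permutes {..<n} \<and> g' -` first_col \<in> ?N}
          \<subseteq> funspace.span (E ` ?N)"
        by (rule funspace.span_minimal) simp
      then show ?thesis using straightening[OF n \<sigma>] by (rule subsetD)
    qed
    have "project w \<in> funspace.span (E ` ?N)" if "w \<in> tensor_module v" for w
      using that unfolding W
    proof (induction rule: funspace.span_induct_alt)
      case base
      show "project 0 \<in> funspace.span (E ` ?N)" by (simp only: project_zero funspace.span_zero)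
    next
      case (step c x y)
      then have "project x \<in> funspace.span (E ` ?N)" using gen by auto
      then show "project (fun_scale c x + y) \<in> funspace.span (E ` ?N)"
        using step by (simp only: project_add project_scale funspace.span_add funspace.span_scale)
    qed
    then show "project ` tensor_module v \<subseteq> funspace.span (E ` ?N)" by blast
  qed
  then show ?thesis using fam(1) by (simp add: card_image)
qed

lemma irrep_multiplicity_hook:
  fixes v :: "'k::field_char_0 mat"
  assumes n: "dim_col v = n"
  shows "irrep_multiplicity n (hook n k) permute_factors (tensor_module v) = card (nbc_family v k)"
proof -
  interpret act: symmetric_action n "permute_factors :: _ \<Rightarrow> ((nat \<Rightarrow> nat) \<Rightarrow> 'k) \<Rightarrow> _"
    by (rule symmetric_action_permute_factors)
  interpret prim: primitive_element n "symmetrizer :: _ \<Rightarrow> 'k"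
    by (rule primitive_element_symmetrizer)
  interpret primitive_element_action n "permute_factors :: _ \<Rightarrow> ((nat \<Rightarrow> nat) \<Rightarrow> 'k) \<Rightarrow> _" "symmetrizer :: _ \<Rightarrow> 'k" ..
  let ?F = "{permute_factors \<sigma> (column_tensor v) | \<sigma>. \<sigma> permutes {..<n}}"
  have "?F = (\<lambda>\<sigma>. permute_factors \<sigma> (column_tensor v)) ` {\<sigma>. \<sigma> permutes {..<n}}" by auto
  then have "finite ?F" by (simp add: finite_permutations)
  moreover have "submodule n permute_factors (tensor_module v)"
    unfolding tensor_module_def n by (rule act.submodule_cyclic)
  moreover have "tensor_module v \<subseteq> funspace.span ?F"
    by (simp add: tensor_module_def cyclic_submodule_def n)
  ultimately have "module_multiplicity n left_mult (specht_module n (hook n k) :: ((nat \<Rightarrow> nat) \<Rightarrow> 'k) set) permute_factors (tensor_module v) =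
      funspace.dim (algebra_act n permute_factors symmetrizer ` tensor_module v)"
    unfolding specht_module_def by (intro multiplicity_eq_dim)
  also have "algebra_act n permute_factors symmetrizer ` tensor_module v = project ` tensor_module v"
    by (simp add: algebra_act_symmetrizer project_def)
  finally show ?thesis
    using dim_project_tensor_module[OF n] is_partition_hook by (simp add: irrep_multiplicity_def)
qed

end

section \<open>Broken circuits of truncations\<close>

lemma finite_indep_column_matroid: "finite (indep (column_matroid v))"
  by (rule finite_subset[of _ "Pow {..<dim_col v}"]) (auto simp: column_matroid_def)

lemma indep_column_matroidD: "I \<in> indep (column_matroid v) \<Longrightarrow> I \<subseteq> {..<dim_col v} \<and> finite I"
  using finite_subset[of I "{..<dim_col v}"] by (auto simp: column_matroid_def)

lemma card_le_matroid_rank: "I \<in> indep (column_matroid v) \<Longrightarrow> card I \<le> matroid_rank (column_matroid v)"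
  unfolding matroid_rank_def using finite_indep_column_matroid by (intro Max_ge) auto

lemma empty_indep_column_matroid: "{} \<in> indep (column_matroid v)"
  by (simp add: column_matroid_def)

lemma obtain_rank_set:
  obtains J where "J \<in> indep (column_matroid v)" "card J = matroid_rank (column_matroid v)"
proof -
  have "matroid_rank (column_matroid v) \<in> card ` indep (column_matroid v)"
    unfolding matroid_rank_def using finite_indep_column_matroid empty_indep_column_matroid
    by (intro Max_in) auto
  then show ?thesis using that by auto
qed

text \<open>
  If no column of \<open>J\<close> extends \<open>I\<close>, all columns of \<open>J\<close> lie in the span of those of \<open>I\<close>, which contradicts
  the Steinitz exchange lemma.
\<close>

lemma column_matroid_augment:
  fixes v :: "'k::field mat"
  assumes I: "I \<in> indep (column_matroid v)" and J: "J \<in> indep (column_matroid v)" and less: "card I < card J"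
  obtains j where "j \<in> J" "j \<notin> I" "insert j I \<in> indep (column_matroid v)"
proof -
  define u where "u j = (\<lambda>a. if a < dim_row v then v $$ (a, j) else 0)" for j
  have sum_u: "(\<Sum>j\<in>K. fun_scale (c j) (u j)) = 0 \<longleftrightarrow> (\<forall>a<dim_row v. (\<Sum>j\<in>K. c j * v $$ (a, j)) = 0)" for K c
  proof -
    have "(\<Sum>j\<in>K. fun_scale (c j) (u j)) a = (if a < dim_row v then \<Sum>j\<in>K. c j * v $$ (a, j) else 0)" for a
      by (simp add: sum_fun_apply fun_scale_apply u_def)
    then show ?thesis by (auto simp: fun_eq_iff)
  qed
  have indep: "K \<in> indep (column_matroid v) \<longleftrightarrow>
      K \<subseteq> {..<dim_col v} \<and> (\<forall>c. (\<Sum>j\<in>K. fun_scale (c j) (u j)) = 0 \<longrightarrow> (\<forall>j\<in>K. c j = 0))" for K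
    unfolding sum_u by (simp add: column_matroid_def)
  have finI: "finite I" and finJ: "finite J" using I J indep_column_matroidD by blast+
  have "\<exists>j\<in>J. j \<notin> I \<and> insert j I \<in> indep (column_matroid v)"
  proof (rule ccontr)
    assume none: "\<not> (\<exists>j\<in>J. j \<notin> I \<and> insert j I \<in> indep (column_matroid v))"
    have "u j \<in> funspace.span (u ` I)" if j: "j \<in> J" for j
    proof (cases "j \<in> I")
      case True
      then show ?thesis by (simp add: funspace.span_base)
    next
      case False
      then have "insert j I \<notin> indep (column_matroid v)" using none j by blast
      moreover have "insert j I \<subseteq> {..<dim_col v}"
        using I J j indep_column_matroidD by blast
      ultimately obtain c i where c: "(\<Sum>i\<in>insert j I. fun_scale (c i) (u i)) = 0" and i: "i \<in> insert j I" "c i \<noteq> 0"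
        unfolding indep by blast
      have eq: "fun_scale (c j) (u j) + (\<Sum>i\<in>I. fun_scale (c i) (u i)) = 0"
        using c finI False by simp
      have "c j \<noteq> 0"
      proof
        assume "c j = 0"
        then have "(\<Sum>i\<in>I. fun_scale (c i) (u i)) = 0" using eq by simp
        then have "\<forall>i\<in>I. c i = 0" using I unfolding indep by blast
        then show False using i \<open>c j = 0\<close> by auto
      qed
      have "fun_scale (c j) (u j) = - (\<Sum>i\<in>I. fun_scale (c i) (u i))"
        using eq by (simp only: eq_neg_iff_add_eq_0)
      moreover have "(\<Sum>i\<in>I. fun_scale (c i) (u i)) \<in> funspace.span (u ` I)"
        by (intro funspace.span_sum funspace.span_scale funspace.span_base) simp
      ultimately have "fun_scale (c j) (u j) \<in> funspace.span (u ` I)"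
        by (simp only: funspace.span_neg)
      then have "fun_scale (1 / c j) (fun_scale (c j) (u j)) \<in> funspace.span (u ` I)"
        by (rule funspace.span_scale)
      then show ?thesis using \<open>c j \<noteq> 0\<close> by simp
    qed
    then have "u ` J \<subseteq> funspace.span (u ` I)" by blast
    moreover have zero: "c j = 0" if "(\<Sum>j\<in>J. fun_scale (c j) (u j)) = 0" "j \<in> J" for c j
      using J that unfolding indep by blast
    have fam: "inj_on u J" "funspace.independent (u ` J)"
      by (rule family_independent[OF finJ]; erule (1) zero)+
    ultimately have "card (u ` J) \<le> card (u ` I)"
      using funspace.independent_span_bound[of "u ` I" "u ` J"] finI by blast
    also have "\<dots> \<le> card I" using finI by (rule card_image_le)
    finally show False using less fam(1) by (simp add: card_image)
  qed
  then show ?thesis using that by blast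
qed

lemma basis_truncation_iff:
  assumes k: "k \<le> matroid_rank (column_matroid v)"
  shows "matroid_basis (truncation (column_matroid v) k) B \<longleftrightarrow> B \<in> indep (column_matroid v) \<and> card B = k"
proof
  assume "matroid_basis (truncation (column_matroid v) k) B"
  then have B: "B \<in> indep (column_matroid v)" "card B \<le> k"
    and maxi: "\<And>I. I \<in> indep (column_matroid v) \<Longrightarrow> card I \<le> k \<Longrightarrow> B \<subseteq> I \<Longrightarrow> I = B"
    by (auto simp: matroid_basis_def truncation_def)
  have "card B = k"
  proof (rule ccontr)
    assume "card B \<noteq> k"
    obtain J where J: "J \<in> indep (column_matroid v)" "card J = matroid_rank (column_matroid v)"
      by (rule obtain_rank_set)
    have "card B < card J" using B(2) \<open>card B \<noteq> k\<close> k J(2) by simp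
    then obtain j where j: "j \<notin> B" "insert j B \<in> indep (column_matroid v)"
      using column_matroid_augment[OF B(1) J(1)] by blast
    have "card (insert j B) \<le> k"
      using B \<open>card B \<noteq> k\<close> j(1) indep_column_matroidD[OF B(1)] by simp
    then have "insert j B = B" using maxi[OF j(2)] by blast
    then show False using j(1) by blast
  qed
  then show "B \<in> indep (column_matroid v) \<and> card B = k" using B(1) by simp
next
  assume "B \<in> indep (column_matroid v) \<and> card B = k"
  moreover have "I = B" if "I \<in> indep (column_matroid v)" "card I \<le> card B" "B \<subseteq> I" for I
    using card_seteq[OF _ that(3,2)] indep_column_matroidD[OF that(1)] by simp
  ultimately show "matroid_basis (truncation (column_matroid v) k) B"
    by (auto simp: matroid_basis_def truncation_def)
qed

lemma circuit_subset:
  assumes D: "finite D" "D \<subseteq> ground M" "D \<notin> indep M"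
  obtains C where "C \<subseteq> D" "matroid_circuit M C"
proof -
  let ?A = "{C. C \<subseteq> D \<and> C \<notin> indep M}"
  have "finite ?A" "?A \<noteq> {}" using D by auto
  then obtain C where C: "C \<in> ?A" "\<forall>C'\<in>?A. C' \<le> C \<longrightarrow> C = C'"
    using finite_has_minimal[of ?A] by blast
  have "matroid_circuit M C"
    unfolding matroid_circuit_def using C D(2) by blast
  then show ?thesis using that C(1) by blast
qed

text \<open>
  Truncation adds as circuits the sets of size \<open>k + 1\<close> that are independent in the matroid and, being
  too large, dependent in the truncation. If \<open>0 \<notin> I\<close>, the dependent set \<open>insert 0 I\<close> contains a circuit
  through \<open>0\<close>, and this circuit without \<open>0\<close> is a broken circuit inside \<open>I\<close>. Conversely, if \<open>0 \<in> I\<close>, a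
  broken circuit of size \<open>k\<close> inside \<open>I\<close> would be \<open>I\<close> itself, but its elements are
  larger than the element removed from the circuit.
\<close>

lemma nbc_bases_truncation:
  assumes k: "1 \<le> k" "k \<le> matroid_rank (column_matroid v)"
  shows "nbc_bases (truncation (column_matroid v) k) = nbc_family v k"
proof -
  let ?M = "column_matroid v" and ?n = "dim_col v"
  let ?T = "truncation ?M k"
  have T: "D \<in> indep ?T \<longleftrightarrow> D \<in> indep ?M \<and> card D \<le> k" "ground ?T = {..<?n}" for D
    by (auto simp: truncation_def column_matroid_def)
  have broken: "\<not> nbc_set ?T I"
    if m: "m < ?n" and D: "D \<subseteq> I" "\<And>i. i \<in> D \<Longrightarrow> m < i" and I: "I \<in> indep ?T" and dep: "insert m D \<notin> indep ?T" for I D m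
  proof -
    have In: "I \<subseteq> {..<?n}" "finite I" using I indep_column_matroidD[of I v] by (auto simp: T)
    have "finite (insert m D)" "insert m D \<subseteq> ground ?T"
      using In D(1) m finite_subset[OF D(1)] by (auto simp: T(2))
    then obtain C where C: "C \<subseteq> insert m D" "matroid_circuit ?T C"
      using circuit_subset[OF _ _ dep] by metis
    have "m \<in> C"
    proof (rule ccontr)
      assume "m \<notin> C"
      then have CI: "C \<subseteq> I" using C(1) D(1) by blast
      then have "C \<in> indep ?M" using I column_matroid_subset[of I v C] by (simp add: T)
      moreover have "card C \<le> k" using card_mono[OF In(2) CI] I by (simp add: T)
      ultimately show False using C(2) by (simp add: matroid_circuit_def T)
    qed
    then have "Min C = m"
      using C(1) D(2) finite_subset[OF C(1)] \<open>finite (insert m D)\<close>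
      by (intro Min_eqI) (auto simp: less_imp_le)
    then have "C - {Min C} \<subseteq> I" using C(1) D(1) by auto
    then show ?thesis using C(2) by (auto simp: nbc_set_def broken_circuit_def)
  qed
  have "matroid_basis ?T I \<and> nbc_set ?T I \<longleftrightarrow> I \<in> nbc_family v k" for I
  proof
    assume I: "matroid_basis ?T I \<and> nbc_set ?T I"
    then have ind: "I \<in> indep ?M" "card I = k" using basis_truncation_iff[OF k(2)] by auto
    then have IT: "I \<in> indep ?T" by (simp add: T)
    have In: "I \<subseteq> {..<?n}" "finite I" using indep_column_matroidD[OF ind(1)] by auto
    have "0 \<in> I"
    proof (rule ccontr)
      assume z: "0 \<notin> I"
      obtain i where "i \<in> I" using ind(2) k(1) by fastforce
      then have "0 < ?n" using In(1) by auto
      moreover have "0 < i" if "i \<in> I" for i using that z by (cases i) auto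
      moreover have "insert 0 I \<notin> indep ?T" using z In(2) ind(2) by (simp add: T)
      ultimately show False using broken[of 0 I I] IT I by auto
    qed
    moreover have "insert m {i \<in> I. m < i} \<in> indep ?M" if "m < ?n" for m
    proof (rule ccontr)
      assume "insert m {i \<in> I. m < i} \<notin> indep ?M"
      then have dep: "insert m {i \<in> I. m < i} \<notin> indep ?T" by (simp add: T)
      have "\<not> nbc_set ?T I" using that IT by (intro broken[OF _ _ _ _ dep]) auto
      then show False using I by simp
    qed
    ultimately show "I \<in> nbc_family v k" using In ind by (simp add: nbc_family_def)
  next
    assume "I \<in> nbc_family v k"
    then have I: "I \<subseteq> {..<?n}" "card I = k" "0 \<in> I"
      and flag: "\<And>m. m < ?n \<Longrightarrow> insert m {i \<in> I. m < i} \<in> indep ?M"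
      by (auto simp: nbc_family_def)
    have fin: "finite I" using I(1) by (rule finite_subset) simp
    have "insert 0 {i \<in> I. 0 < i} = I" using I(3) by auto
    then have ind: "I \<in> indep ?M" using flag[of 0] I(1,3) by auto
    have "\<not> C - {Min C} \<subseteq> I" if C: "matroid_circuit ?T C" for C
    proof
      assume CI: "C - {Min C} \<subseteq> I"
      have "C \<noteq> {}" using C empty_indep_column_matroid by (auto simp: matroid_circuit_def T)
      have Cn: "C \<subseteq> {..<?n}" using C by (simp add: matroid_circuit_def T)
      then have finC: "finite C" by (rule finite_subset) simp
      define m where "m = Min C"
      have m: "m \<in> C" "\<And>i. i \<in> C \<Longrightarrow> m \<le> i" unfolding m_def using finC \<open>C \<noteq> {}\<close> by auto
      have sub: "C \<subseteq> insert m {i \<in> I. m < i}"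
      proof
        fix i assume "i \<in> C"
        then show "i \<in> insert m {i \<in> I. m < i}"
          using CI m(2)[of i] by (cases "i = m") (auto simp: m_def)
      qed
      have "m < ?n" using m(1) Cn by auto
      from column_matroid_subset[OF flag[OF this] sub] have "C \<in> indep ?M" .
      then have "k < card C" using C by (auto simp: matroid_circuit_def T)
      then have "card I \<le> card (C - {m})" using m(1) I(2) finC by simp
      then have "C - {m} = I" using CI fin by (intro card_seteq) (auto simp: m_def)
      then have "0 \<in> C" "0 \<noteq> m" using I(3) by auto
      then show False using m(2)[of 0] by simp
    qed
    then have "nbc_set ?T I" using I(1) by (auto simp: nbc_set_def broken_circuit_def T)
    then show "matroid_basis ?T I \<and> nbc_set ?T I"
      using basis_truncation_iff[OF k(2)] ind I(2) by simp
  qed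
  then show ?thesis by (auto simp: nbc_bases_def)
qed

lemma nbc_family_empty:
  assumes "1 \<le> k" "matroid_rank (column_matroid v) < k"
  shows "nbc_family v k = {}"
proof (rule ccontr)
  assume "nbc_family v k \<noteq> {}"
  then obtain I where "I \<in> nbc_family v k" by blast
  then have I: "I \<subseteq> {..<dim_col v}" "card I = k" "0 \<in> I"
    and flag: "\<And>m. m < dim_col v \<Longrightarrow> insert m {i \<in> I. m < i} \<in> indep (column_matroid v)"
    by (auto simp: nbc_family_def)
  have "insert 0 {i \<in> I. 0 < i} = I" using I(3) by auto
  then have "I \<in> indep (column_matroid v)" using flag[of 0] I(1,3) by auto
  then show False using card_le_matroid_rank[of I v] I(2) assms(2) by simp
qed

theorem theorem9p1:
  fixes v :: "'k::{alg_closed_field, field_char_0} mat"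
    and r n k :: nat
  assumes "v \<in> carrier_mat r n"
    and "k \<ge> 1"
  shows "(k \<le> matroid_rank (column_matroid v) \<longrightarrow>
            irrep_multiplicity n (hook n k) permute_factors (tensor_module v) =
              card (nbc_bases (truncation (column_matroid v) k)))
       \<and> (k > matroid_rank (column_matroid v) \<longrightarrow>
            irrep_multiplicity n (hook n k) permute_factors (tensor_module v) = 0)"
proof (cases "k \<le> n")
  case True
  have n: "dim_col v = n" using assms(1) by auto
  interpret hook_shape n k using assms(2) True by unfold_locales
  show ?thesis
    using irrep_multiplicity_hook[OF n] nbc_bases_truncation[OF assms(2), of v] nbc_family_empty[OF assms(2), of v]
    by auto
next
  case False
  have n: "dim_col v = n" using assms(1) by auto
  obtain J where J: "J \<in> indep (column_matroid v)" "card J = matroid_rank (column_matroid v)"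
    by (rule obtain_rank_set)
  have "card J \<le> n"
    using indep_column_matroidD[OF J(1)] card_mono[of "{..<n}" J] n by simp
  \<comment> \<open>for \<open>k > n\<close> the first part of the hook is zero\<close>
  moreover have "\<not> is_partition n (hook n k)"
    using False by (simp add: is_partition_def hook_def)
  ultimately show ?thesis using False J(2) by (simp add: irrep_multiplicity_def)
qed

end
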